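(* Let $n\ge 1$. An element $f\in\mathbb{Z}_2\llbracket\xi_1,\dots,\xi_n\rrbracket$ is hit if and only if $\|f\|_A<1$. In other words, the set $H(n)$ of hit elements is $$H(n)=B_A(0,1)\,\mathbb{Z}_2\llbracket\xi_1,\dots,\xi_n\rrbracket .$$
   Context: $\mathbb{Z}_2$ is the ring of dyadic ($2$-adic) integers and $\mathbb{Q}_2$ its fraction field. The polynomial ring $\mathbb{Z}_2[\xi_1,\dots,\xi_n]$ is graded by $\deg\xi_i=1$. $Jq$ is the $\mathbb{Z}_2$-algebra endomorphism of $\mathbb{Z}_2[\xi_1,\dots,\xi_n]$ with $Jq(1)=1$, $Jq(\xi_i)=\xi_i+\xi_i^2$. For $k\ge0$, the dyadic Steenrod square $Jq^k$ is the $\mathbb{Z}_2$-linear map raising degree by $k$ obtained, on each homogeneous degree $d$, by restricting $Jq$ to degree $d$ and projecting onto degree $d+k$; so $Jq=\sum_{k\ge0}Jq^k$ and $Jq^0=1$. The $Jq^k$ act degreewise on $\mathbb{Z}_2\llbracket\xi_1,\dots,\xi_n\rrbracket$. The dyadic Steenrod algebra $\mathcal{J}_2$ is the $\mathbb{Z}_2$-algebra generated under composition by the $Jq^k$, $k\ge0$, two elements being equal when they agree as operators on $\mathbb{Z}_2[\xi_1,\dots,\xi_n]$ for every $n$. Adem norm: in the $\mathbb{Q}_2$-algebra $\mathcal{J}_2\otimes_{\mathbb{Z}_2}\mathbb{Q}_2$ let $\mathcal{J}_2^+$ be the two-sided ideal generated by $Jq^1,Jq^2$ (equivalently by all $Jq^k$,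 $k>0$). Then $\|\theta\|_A=2^{-j}$, where $j\ge 0$ is the largest integer with $\theta\in(\mathcal{J}_2^+)^j$ (with $(\mathcal{J}_2^+)^0$ the whole algebra), and $\|0\|_A=0$. This norm is restricted to $\mathcal{J}_2$, and $B_A(0,r)=\{\theta\in\mathcal{J}_2 : \|\theta\|_A<r\}$. For $M=\mathbb{Z}_2\llbracket\xi_1,\dots,\xi_n\rrbracket$ and $B\subseteq \mathcal{J}_2$, $BM$ is the set of finite sums $\sum_i\theta_i(f_i)$ with $\theta_i\in B$, $f_i\in M$. The Adem norm on $M$ is the one given by the filtration $B_A(0,2^{-k})M$, $k\ge0$: $\|f\|_A=\inf\big(\{1\}\cup\{2^{-k-1}: k\ge 0,\ f\in B_A(0,2^{-k})M\}\big)$. An element $f\in \mathbb{Z}_2\llbracket\xi_1,\dots,\xi_n\rrbracket$ is hit if there is a finite sum $f=\sum_{i>0}Jq^i(f_i)$ with $f_i\in \mathbb{Z}_2\llbracket\xi_1,\dots,\xi_n\rrbracket$ in positive degree (zero constant term). *)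

theory Defs
  imports Complex_Main "HOL-Library.Poly_Mapping" "HOL-Computational_Algebra.Polynomial_Factorial"
begin

section \<open>The dyadic integers\<close>

text \<open>
  \<open>\<int>\<^sub>2\<close> is the inverse limit of the rings \<open>\<int>/2\<^sup>k\<int>\<close>: an element is a compatible sequence of residues,
  the \<open>k\<close>-th one being represented in \<open>{0..<2 ^ k}\<close>. (The range condition follows from compatibility.)
  The fraction field \<open>\<rat>\<^sub>2\<close> is the type \<open>dyadic fract\<close>.
\<close>

typedef dyadic = "{a :: nat \<Rightarrow> int. \<forall>k. a (Suc k) mod 2 ^ k = a k}"
  morphisms residue Abs_dyadic
  by (rule exI[of _ "\<lambda>_. 0"]) simp

setup_lifting type_definition_dyadic

lemma mod_pow_Suc: "(x::int) mod 2 ^ Suc k mod 2 ^ k = x mod 2 ^ k"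
  by (rule mod_mod_cancel) simp

lemma residue_Suc: "residue a (Suc k) mod 2 ^ k = residue a k"
  by transfer simp

lemma residue_mod: "residue a k mod 2 ^ k = residue a k"
  by (metis residue_Suc mod_mod_trivial)

lemma residue_0 [simp]: "residue a 0 = 0"
  using residue_mod[of a 0] by simp

lemma dyadic_eqI: "(\<And>k. residue a k = residue b k) \<Longrightarrow> a = b"
  by transfer auto

instantiation dyadic :: comm_ring_1
begin

lift_definition zero_dyadic :: dyadic is "\<lambda>_. 0"
  by simp

lift_definition one_dyadic :: dyadic is "\<lambda>k. 1 mod 2 ^ k"
  by (simp only: mod_pow_Suc)

lift_definition plus_dyadic :: "dyadic \<Rightarrow> dyadic \<Rightarrow> dyadic" is "\<lambda>a b k. (a k + b k) mod 2 ^ k"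
  by (simp only: mod_pow_Suc) (metis mod_add_eq)

lift_definition minus_dyadic :: "dyadic \<Rightarrow> dyadic \<Rightarrow> dyadic" is "\<lambda>a b k. (a k - b k) mod 2 ^ k"
  by (simp only: mod_pow_Suc) (metis mod_diff_eq)

lift_definition uminus_dyadic :: "dyadic \<Rightarrow> dyadic" is "\<lambda>a k. (- a k) mod 2 ^ k"
  by (simp only: mod_pow_Suc) (metis mod_minus_eq)

lift_definition times_dyadic :: "dyadic \<Rightarrow> dyadic \<Rightarrow> dyadic" is "\<lambda>a b k. (a k * b k) mod 2 ^ k"
  by (simp only: mod_pow_Suc) (metis mod_mult_eq)

instance
proof
  fix a b c :: dyadic
  show "a * b * c = a * (b * c)"
    by (rule dyadic_eqI) (simp add: times_dyadic.rep_eq mod_simps mult.assoc)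
  show "a * b = b * a"
    by (rule dyadic_eqI) (simp add: times_dyadic.rep_eq mult.commute)
  show "1 * a = a"
    by (rule dyadic_eqI) (simp add: times_dyadic.rep_eq one_dyadic.rep_eq mod_simps residue_mod)
  show "a + b + c = a + (b + c)"
    by (rule dyadic_eqI) (simp add: plus_dyadic.rep_eq mod_simps add.assoc)
  show "a + b = b + a"
    by (rule dyadic_eqI) (simp add: plus_dyadic.rep_eq add.commute)
  show "0 + a = a"
    by (rule dyadic_eqI) (simp add: plus_dyadic.rep_eq zero_dyadic.rep_eq residue_mod)
  show "- a + a = 0"
    by (rule dyadic_eqI)
      (simp add: plus_dyadic.rep_eq zero_dyadic.rep_eq uminus_dyadic.rep_eq mod_simps)
  show "a - b = a + - b"
    by (rule dyadic_eqI)
      (simp add: plus_dyadic.rep_eq minus_dyadic.rep_eq uminus_dyadic.rep_eq mod_simps)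
  show "(a + b) * c = a * c + b * c"
    by (rule dyadic_eqI) (simp add: plus_dyadic.rep_eq times_dyadic.rep_eq mod_simps distrib_right)
  have "residue 0 1 \<noteq> residue 1 1"
    by (simp add: zero_dyadic.rep_eq one_dyadic.rep_eq)
  then show "(0::dyadic) \<noteq> 1"
    by metis
qed

end

lemma residue_mod_le: "i \<le> j \<Longrightarrow> residue a j mod 2 ^ i = residue a i"
proof (induction j rule: dec_induct)
  case base
  show ?case by (rule residue_mod)
next
  case (step j)
  have "residue a (Suc j) mod 2 ^ i = residue a (Suc j) mod 2 ^ j mod 2 ^ i"
    using step.hyps by (simp add: mod_mod_cancel le_imp_power_dvd)
  then show ?case using step.IH by (simp add: residue_Suc)
qed

lemma int_pow2_mult_not_dvd:
  fixes x y :: int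
  assumes "\<not> 2 ^ i dvd x" "\<not> 2 ^ j dvd y"
  shows "\<not> 2 ^ (i + j) dvd x * y"
proof
  assume *: "2 ^ (i + j) dvd x * y"
  have "x \<noteq> 0" "y \<noteq> 0" using assms by auto
  have p: "prime_elem (2::int)" by (rule prime_imp_prime_elem) simp
  have "i + j \<le> multiplicity 2 (x * y)"
    using * \<open>x \<noteq> 0\<close> \<open>y \<noteq> 0\<close> by (intro multiplicity_geI) auto
  also have "\<dots> = multiplicity 2 x + multiplicity 2 y"
    using p \<open>x \<noteq> 0\<close> \<open>y \<noteq> 0\<close> by (rule prime_elem_multiplicity_mult_distrib)
  finally have "i \<le> multiplicity 2 x \<or> j \<le> multiplicity 2 y" by linarith
  then show False using assms by (auto intro: multiplicity_dvd')
qed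

instance dyadic :: idom
proof
  fix a b :: dyadic
  assume "a \<noteq> 0" "b \<noteq> 0"
  then obtain i j where ij: "residue a i \<noteq> 0" "residue b j \<noteq> 0"
    by (metis dyadic_eqI zero_dyadic.rep_eq)
  have "\<not> 2 ^ i dvd residue a (i + j)" "\<not> 2 ^ j dvd residue b (i + j)"
    using ij residue_mod_le[of i "i + j" a] residue_mod_le[of j "i + j" b]
    by (auto simp: dvd_eq_mod_eq_0)
  then have "\<not> 2 ^ (i + j) dvd residue a (i + j) * residue b (i + j)"
    by (rule int_pow2_mult_not_dvd)
  then have "residue (a * b) (i + j) \<noteq> 0"
    by (simp add: times_dyadic.rep_eq dvd_eq_mod_eq_0)
  then show "a * b \<noteq> 0"
    by (metis zero_dyadic.rep_eq)
qed


section \<open>Polynomials, power series and the dyadic Steenrod squares\<close>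

text \<open>
  Exponent vectors are finitely supported functions on \<open>nat\<close>, and \<open>dyadic mpoly\<close> is
  \<open>\<int>\<^sub>2[\<xi>\<^sub>1, \<xi>\<^sub>2, \<dots>]\<close>, the union of the rings \<open>\<int>\<^sub>2[\<xi>\<^sub>1, \<dots>, \<xi>\<^sub>n]\<close>; \<open>\<xi>\<^sub>i\<^sub>+\<^sub>1\<close> is the variable with
  index \<open>i\<close>. Two operators on \<open>dyadic mpoly\<close> are thus equal iff they agree on
  \<open>\<int>\<^sub>2[\<xi>\<^sub>1, \<dots>, \<xi>\<^sub>n]\<close> for every \<open>n\<close>.
\<close>

type_synonym mono = "nat \<Rightarrow>\<^sub>0 nat"
type_synonym 'a mpoly = "mono \<Rightarrow>\<^sub>0 'a"
type_synonym 'a mseries = "mono \<Rightarrow> 'a"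

alias lookup = Poly_Mapping.lookup
alias keys = Poly_Mapping.keys

definition mdeg :: "mono \<Rightarrow> nat" where
  "mdeg m = (\<Sum>i\<in>keys m. lookup m i)"

definition X :: "nat \<Rightarrow> dyadic mpoly" where
  "X i = Poly_Mapping.single (Poly_Mapping.single i 1) 1"

definition scale :: "'a::comm_ring_1 \<Rightarrow> 'a mpoly \<Rightarrow> 'a mpoly" where
  "scale c p = Poly_Mapping.single 0 c * p"

definition series :: "nat \<Rightarrow> dyadic mseries set" where
  "series n = {f. \<forall>m. f m \<noteq> 0 \<longrightarrow> keys m \<subseteq> {..<n}}"

text \<open>
  The homogeneous component of degree \<open>d\<close>; for polynomials it is applied to \<open>lookup p\<close>.
  The index set of the sum is finite for every \<open>f \<in> series n\<close>.
\<close>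
definition hpart :: "nat \<Rightarrow> dyadic mseries \<Rightarrow> dyadic mpoly" where
  "hpart d f = (\<Sum>m | f m \<noteq> 0 \<and> mdeg m = d. Poly_Mapping.single m (f m))"

definition Jq :: "dyadic mpoly \<Rightarrow> dyadic mpoly" where
  "Jq p = (\<Sum>m\<in>keys p. scale (lookup p m) (\<Prod>i\<in>keys m. (X i + X i ^ 2) ^ lookup m i))"

definition Jqk :: "nat \<Rightarrow> dyadic mpoly \<Rightarrow> dyadic mpoly" where
  "Jqk k p = (\<Sum>d\<in>mdeg ` keys p. hpart (d + k) (lookup (Jq (hpart d (lookup p)))))"

text \<open>
  The degreewise action on power series of an operator that does not lower degrees: the
  coefficient of \<open>m\<close> only receives contributions from the components of degree at most \<open>mdeg m\<close>.
\<close>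
definition act :: "(dyadic mpoly \<Rightarrow> dyadic mpoly) \<Rightarrow> dyadic mseries \<Rightarrow> dyadic mseries" where
  "act \<theta> f = (\<lambda>m. \<Sum>d\<le>mdeg m. lookup (\<theta> (hpart d f)) m)"


section \<open>The dyadic Steenrod algebra and the Adem norm\<close>

inductive_set J2 :: "(dyadic mpoly \<Rightarrow> dyadic mpoly) set" where
  gen: "Jqk k \<in> J2"
| scale: "\<theta> \<in> J2 \<Longrightarrow> (\<lambda>p. scale c (\<theta> p)) \<in> J2"
| add: "\<theta> \<in> J2 \<Longrightarrow> \<eta> \<in> J2 \<Longrightarrow> (\<lambda>p. \<theta> p + \<eta> p) \<in> J2"
| comp: "\<theta> \<in> J2 \<Longrightarrow> \<eta> \<in> J2 \<Longrightarrow> \<theta> \<circ> \<eta> \<in> J2"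

text \<open>
  The algebra \<open>J2 \<otimes> \<rat>\<^sub>2\<close> is realised as the \<open>\<rat>\<^sub>2\<close>-span, among the operators on
  \<open>\<rat>\<^sub>2[\<xi>\<^sub>1, \<xi>\<^sub>2, \<dots>]\<close>, of the \<open>\<rat>\<^sub>2\<close>-linear extensions \<open>base_change \<theta>\<close> of the elements of \<open>J2\<close>;
  \<open>base_change \<theta>\<close> is the element \<open>\<theta> \<otimes> 1\<close>. That this is the tensor product (that is, the
  localisation of \<open>J2\<close> at the nonzero elements of \<open>\<int>\<^sub>2\<close>) is the content of the lemmas
  \<open>base_change_scale\<close>, \<open>base_change_add\<close>, \<open>base_change_comp\<close>, \<open>base_change_inj\<close> and
  \<open>J2Q_iff\<close> below.
\<close>

definition to_Q :: "dyadic mpoly \<Rightarrow> dyadic fract mpoly" where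
  "to_Q p = Poly_Mapping.map to_fract p"

definition base_change ::
  "(dyadic mpoly \<Rightarrow> dyadic mpoly) \<Rightarrow> dyadic fract mpoly \<Rightarrow> dyadic fract mpoly" where
  "base_change \<theta> p = (\<Sum>m\<in>keys p. scale (lookup p m) (to_Q (\<theta> (Poly_Mapping.single m 1))))"

inductive_set J2Q :: "(dyadic fract mpoly \<Rightarrow> dyadic fract mpoly) set" where
  base: "\<theta> \<in> J2 \<Longrightarrow> base_change \<theta> \<in> J2Q"
| scale: "\<theta> \<in> J2Q \<Longrightarrow> (\<lambda>p. scale c (\<theta> p)) \<in> J2Q"
| add: "\<theta> \<in> J2Q \<Longrightarrow> \<eta> \<in> J2Q \<Longrightarrow> (\<lambda>p. \<theta> p + \<eta> p) \<in> J2Q"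

inductive_set J2plus :: "(dyadic fract mpoly \<Rightarrow> dyadic fract mpoly) set" where
  gen1: "base_change (Jqk 1) \<in> J2plus"
| gen2: "base_change (Jqk 2) \<in> J2plus"
| add: "\<theta> \<in> J2plus \<Longrightarrow> \<eta> \<in> J2plus \<Longrightarrow> (\<lambda>p. \<theta> p + \<eta> p) \<in> J2plus"
| left: "\<alpha> \<in> J2Q \<Longrightarrow> \<theta> \<in> J2plus \<Longrightarrow> \<alpha> \<circ> \<theta> \<in> J2plus"
| right: "\<theta> \<in> J2plus \<Longrightarrow> \<alpha> \<in> J2Q \<Longrightarrow> \<theta> \<circ> \<alpha> \<in> J2plus"

inductive_set ideal_mult ::
  "('a \<Rightarrow> 'a::comm_monoid_add) set \<Rightarrow> ('a \<Rightarrow> 'a) set \<Rightarrow> ('a \<Rightarrow> 'a) set"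
  for A B where
  zero: "(\<lambda>_. 0) \<in> ideal_mult A B"
| prod: "\<theta> \<in> A \<Longrightarrow> \<eta> \<in> B \<Longrightarrow> \<theta> \<circ> \<eta> \<in> ideal_mult A B"
| add: "\<theta> \<in> ideal_mult A B \<Longrightarrow> \<eta> \<in> ideal_mult A B \<Longrightarrow> (\<lambda>p. \<theta> p + \<eta> p) \<in> ideal_mult A B"

primrec J2plus_power :: "nat \<Rightarrow> (dyadic fract mpoly \<Rightarrow> dyadic fract mpoly) set" where
  "J2plus_power 0 = J2Q"
| "J2plus_power (Suc j) = ideal_mult (J2plus_power j) J2plus"

definition adem_norm_Q :: "(dyadic fract mpoly \<Rightarrow> dyadic fract mpoly) \<Rightarrow> real" where
  "adem_norm_Q \<theta> = (if \<theta> = (\<lambda>_. 0) then 0 else 1 / 2 ^ (GREATEST j. \<theta> \<in> J2plus_power j))"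

definition adem_norm :: "(dyadic mpoly \<Rightarrow> dyadic mpoly) \<Rightarrow> real" where
  "adem_norm \<theta> = adem_norm_Q (base_change \<theta>)"

definition adem_ball :: "real \<Rightarrow> (dyadic mpoly \<Rightarrow> dyadic mpoly) set" where
  "adem_ball r = {\<theta> \<in> J2. adem_norm \<theta> < r}"

definition op_series ::
  "(dyadic mpoly \<Rightarrow> dyadic mpoly) set \<Rightarrow> dyadic mseries set \<Rightarrow> dyadic mseries set" where
  "op_series B M = {f. \<exists>(r::nat) \<theta> g. (\<forall>i<r. \<theta> i \<in> B \<and> g i \<in> M) \<and>
                        f = (\<lambda>m. \<Sum>i<r. act (\<theta> i) (g i) m)}"

definition adem_norm_series :: "nat \<Rightarrow> dyadic mseries \<Rightarrow> real" where
  "adem_norm_series n f =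
     Inf ({1} \<union> {1 / 2 ^ (k + 1) | k :: nat. f \<in> op_series (adem_ball (1 / 2 ^ k)) (series n)})"

definition hit :: "nat \<Rightarrow> dyadic mseries \<Rightarrow> bool" where
  "hit n f \<longleftrightarrow> (\<exists>r g. (\<forall>i\<in>{1..r}. g i \<in> series n \<and> g i 0 = 0) \<and>
                      f = (\<lambda>m. \<Sum>i = 1..r. act (Jqk i) (g i) m))"

definition hit_set :: "nat \<Rightarrow> dyadic mseries set" where
  "hit_set n = {f \<in> series n. hit n f}"


section \<open>Consistency of the definitions\<close>

subsection \<open>\<open>Jq\<close> is the algebra endomorphism with \<open>\<xi>\<^sub>i \<mapsto> \<xi>\<^sub>i + \<xi>\<^sub>i\<^sup>2\<close>\<close>

lemma lookup_scale [simp]: "lookup (scale c p) m = c * lookup p m"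
  unfolding scale_def mult_map_scale_conv_mult[symmetric]
  by (simp add: Poly_Mapping.map.rep_eq when_def)

lemma scale_zero_left [simp]: "scale 0 p = 0"
  and scale_zero_right [simp]: "scale c 0 = 0"
  and scale_one [simp]: "scale 1 p = p"
  and scale_add_left: "scale (a + b) p = scale a p + scale b p"
  and scale_add_right: "scale c (p + q) = scale c p + scale c q"
  and scale_scale [simp]: "scale a (scale b p) = scale (a * b) p"
  by (rule poly_mapping_eqI; simp add: lookup_add algebra_simps)+

lemma scale_sum_right: "scale c (sum f A) = (\<Sum>x\<in>A. scale c (f x))"
  by (rule poly_mapping_eqI) (simp add: lookup_sum sum_distrib_left)

lemma scale_mult_left: "scale c p * q = scale c (p * q)"
  and scale_mult_right: "p * scale c q = scale c (p * q)"
  by (simp_all add: scale_def ac_simps)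

lemma scale_single: "scale c (Poly_Mapping.single m a) = Poly_Mapping.single m (c * a)"
  by (simp add: scale_def mult_single)

text \<open>A sum over the monomials of a polynomial may be taken over any larger finite set.\<close>

lemma sum_keys_mono:
  assumes "finite A" "keys p \<subseteq> A"
  shows "(\<Sum>m\<in>keys p. scale (lookup p m) (g m)) = (\<Sum>m\<in>A. scale (lookup p m) (g m))"
  using assms by (intro sum.mono_neutral_left) (auto simp: in_keys_iff)

lemma sum_keys_add:
  "(\<Sum>m\<in>keys (p + q). scale (lookup (p + q) m) (g m)) =
   (\<Sum>m\<in>keys p. scale (lookup p m) (g m)) + (\<Sum>m\<in>keys q. scale (lookup q m) (g m))"
proof -
  let ?A = "keys p \<union> keys q"
  have fin: "finite ?A" by simp
  show ?thesis
    unfolding sum_keys_mono[OF fin Poly_Mapping.keys_add]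
      sum_keys_mono[OF fin Un_upper1] sum_keys_mono[OF fin Un_upper2]
    by (simp add: lookup_add scale_add_left sum.distrib)
qed

lemma sum_keys_scale:
  "(\<Sum>m\<in>keys (scale c p). scale (lookup (scale c p) m) (g m)) =
   scale c (\<Sum>m\<in>keys p. scale (lookup p m) (g m))"
proof -
  have sub: "keys (scale c p) \<subseteq> keys p" by (auto simp: in_keys_iff)
  show ?thesis
    unfolding sum_keys_mono[OF finite_keys sub]
    by (simp add: scale_sum_right)
qed

lemma poly_expand: "p = (\<Sum>m\<in>keys p. scale (lookup p m) (Poly_Mapping.single m 1))"
proof (rule poly_mapping_eqI)
  fix k
  have "lookup (\<Sum>m\<in>keys p. scale (lookup p m) (Poly_Mapping.single m 1)) k =
        (\<Sum>m\<in>keys p. if m = k then lookup p m else 0)"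
    unfolding lookup_sum by (rule sum.cong) (auto simp: lookup_single when_def)
  also have "\<dots> = lookup p k"
    by (simp add: in_keys_iff)
  finally show "lookup p k = lookup (\<Sum>m\<in>keys p. scale (lookup p m) (Poly_Mapping.single m 1)) k"
    by simp
qed

lemma Jq_zero [simp]: "Jq 0 = 0"
  by (simp add: Jq_def)

lemma Jq_add: "Jq (p + q) = Jq p + Jq q"
  unfolding Jq_def by (rule sum_keys_add)

lemma Jq_scale: "Jq (scale c p) = scale c (Jq p)"
  unfolding Jq_def by (rule sum_keys_scale)

lemma Jq_sum: "Jq (sum f A) = (\<Sum>x\<in>A. Jq (f x))"
  by (induction A rule: infinite_finite_induct) (simp_all add: Jq_add)

lemma Jq_single:
  "Jq (Poly_Mapping.single m 1) = (\<Prod>i\<in>keys m. (X i + X i ^ 2) ^ lookup m i)"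
  by (simp add: Jq_def)

lemma Jq_single_add:
  "Jq (Poly_Mapping.single (a + b) 1) = Jq (Poly_Mapping.single a 1) * Jq (Poly_Mapping.single b 1)"
proof -
  let ?A = "keys a \<union> keys b"
  have *: "(\<Prod>i\<in>keys m. (X i + X i ^ 2) ^ lookup m i) = (\<Prod>i\<in>?A. (X i + X i ^ 2) ^ lookup m i)"
    if "keys m \<subseteq> ?A" for m
    using that by (intro prod.mono_neutral_left) (auto simp: in_keys_iff)
  show ?thesis
    unfolding Jq_single *[OF Poly_Mapping.keys_add] *[OF Un_upper1] *[OF Un_upper2]
    by (simp add: lookup_add power_add prod.distrib)
qed

lemma Jq_mult: "Jq (p * q) = Jq p * Jq q"
proof -
  let ?s = "\<lambda>m. Poly_Mapping.single m (1::dyadic)"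
  have "p * q = (\<Sum>a\<in>keys p. scale (lookup p a) (?s a)) * (\<Sum>b\<in>keys q. scale (lookup q b) (?s b))"
    using poly_expand[of p] poly_expand[of q] by simp
  also have "\<dots> = (\<Sum>a\<in>keys p. \<Sum>b\<in>keys q. scale (lookup p a) (scale (lookup q b) (?s (a + b))))"
    by (simp only: sum_product scale_mult_left scale_mult_right mult_single mult_1 scale_scale)
      (simp add: mult.commute)
  finally have "Jq (p * q) =
      (\<Sum>a\<in>keys p. \<Sum>b\<in>keys q. scale (lookup p a) (scale (lookup q b) (Jq (?s a) * Jq (?s b))))"
    by (simp only: Jq_sum Jq_scale Jq_single_add)
  also have "\<dots> = (\<Sum>a\<in>keys p. scale (lookup p a) (Jq (?s a))) * (\<Sum>b\<in>keys q. scale (lookup q b) (Jq (?s b)))"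
    by (simp only: sum_product scale_mult_left scale_mult_right scale_scale) (simp add: mult.commute)
  also have "\<dots> = Jq p * Jq q"
    by (simp only: Jq_single) (simp only: Jq_def)
  finally show ?thesis .
qed

lemma Jq_one: "Jq 1 = 1"
  by (simp add: Jq_def)

lemma Jq_X: "Jq (X i) = X i + X i ^ 2"
  unfolding X_def Jq_single by (simp add: X_def)


subsection \<open>\<open>J2Q\<close> is the tensor product of \<open>J2\<close> with \<open>\<rat>\<^sub>2\<close>\<close>

lemma finite_hpart: "finite {m. lookup (p :: dyadic mpoly) m \<noteq> 0 \<and> mdeg m = d}"
  by (rule finite_subset[OF _ finite_keys[of p]]) (auto simp: in_keys_iff)

lemma lookup_hpart: "lookup (hpart d (lookup p)) m = (if mdeg m = d then lookup p m else 0)"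
  using finite_hpart[of p d]
  by (auto simp: hpart_def lookup_sum lookup_single when_def sum.delta)

lemma hpart_add: "hpart d (lookup (p + q)) = hpart d (lookup p) + hpart d (lookup q)"
  and hpart_scale: "hpart d (lookup (scale c p)) = scale c (hpart d (lookup p))"
  by (rule poly_mapping_eqI; simp add: lookup_hpart lookup_add)+

lemma Jqk_mono:
  assumes "finite D" "mdeg ` keys p \<subseteq> D"
  shows "Jqk k p = (\<Sum>d\<in>D. hpart (d + k) (lookup (Jq (hpart d (lookup p)))))"
proof -
  have "hpart (d + k) (lookup (Jq (hpart d (lookup p)))) = 0" if "d \<notin> mdeg ` keys p" for d
  proof -
    have "hpart d (lookup p) = 0"
      using that by (intro poly_mapping_eqI) (auto simp: lookup_hpart in_keys_iff)
    then have "Jq (hpart d (lookup p)) = 0" by simp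
    then show ?thesis by (intro poly_mapping_eqI) (simp only: lookup_hpart lookup_zero if_cancel)
  qed
  then show ?thesis
    unfolding Jqk_def using assms by (intro sum.mono_neutral_left) auto
qed

definition op_linear :: "('a::comm_ring_1 mpoly \<Rightarrow> 'a mpoly) \<Rightarrow> bool" where
  "op_linear \<theta> \<longleftrightarrow> (\<forall>p q. \<theta> (p + q) = \<theta> p + \<theta> q) \<and> (\<forall>c p. \<theta> (scale c p) = scale c (\<theta> p))"

lemma Jqk_linear: "op_linear (Jqk k)"
  unfolding op_linear_def
proof (intro conjI allI)
  fix p q :: "dyadic mpoly"
  let ?D = "mdeg ` keys p \<union> mdeg ` keys q"
  have "mdeg ` keys (p + q) \<subseteq> ?D" using Poly_Mapping.keys_add[of p q] by blast
  then show "Jqk k (p + q) = Jqk k p + Jqk k q"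
    by (simp add: Jqk_mono[of ?D] hpart_add Jq_add sum.distrib)
next
  fix c :: dyadic and p :: "dyadic mpoly"
  have "mdeg ` keys (scale c p) \<subseteq> mdeg ` keys p" by (auto simp: in_keys_iff)
  then show "Jqk k (scale c p) = scale c (Jqk k p)"
    by (simp add: Jqk_mono[of "mdeg ` keys p"] hpart_scale Jq_scale scale_sum_right)
qed

lemma J2_linear: "\<theta> \<in> J2 \<Longrightarrow> op_linear \<theta>"
proof (induction rule: J2.induct)
  case (gen k)
  show ?case by (rule Jqk_linear)
qed (auto simp: op_linear_def scale_add_right ac_simps)

lemma op_linear_sum:
  assumes "op_linear \<theta>"
  shows "\<theta> (sum f A) = (\<Sum>x\<in>A. \<theta> (f x))"
proof -
  have "\<theta> (scale 0 0) = scale 0 (\<theta> 0)" using assms unfolding op_linear_def by blast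
  then have "\<theta> 0 = 0" by simp
  then show ?thesis
    using assms by (induction A rule: infinite_finite_induct) (simp_all add: op_linear_def)
qed

lemma op_linear_expand:
  assumes "op_linear \<theta>"
  shows "\<theta> p = (\<Sum>m\<in>keys p. scale (lookup p m) (\<theta> (Poly_Mapping.single m 1)))"
proof -
  have "\<theta> p = \<theta> (\<Sum>m\<in>keys p. scale (lookup p m) (Poly_Mapping.single m 1))"
    using poly_expand[of p] by simp
  then show ?thesis
    using assms by (simp add: op_linear_sum op_linear_def)
qed

lemma lookup_to_Q [simp]: "lookup (to_Q p) m = to_fract (lookup p m)"
  by (simp add: to_Q_def Poly_Mapping.map.rep_eq when_def)

lemma to_Q_add: "to_Q (p + q) = to_Q p + to_Q q"
  and to_Q_scale: "to_Q (scale c p) = scale (to_fract c) (to_Q p)"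
  and to_Q_zero [simp]: "to_Q 0 = 0"
  and to_Q_single: "to_Q (Poly_Mapping.single m c) = Poly_Mapping.single m (to_fract c)"
  by (rule poly_mapping_eqI; simp add: lookup_add lookup_single when_def)+

lemma to_Q_sum: "to_Q (sum f A) = (\<Sum>x\<in>A. to_Q (f x))"
  by (induction A rule: infinite_finite_induct) (simp_all add: to_Q_add)

lemma to_Q_inj: "to_Q p = to_Q q \<longleftrightarrow> p = q"
  by (metis lookup_to_Q poly_mapping_eqI to_fract_eq_iff)

lemma base_change_linear: "op_linear (base_change \<theta>)"
  unfolding op_linear_def base_change_def by (intro conjI allI sum_keys_add sum_keys_scale)

lemma base_change_to_Q:
  assumes "op_linear \<theta>"
  shows "base_change \<theta> (to_Q p) = to_Q (\<theta> p)"
proof -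
  have "keys (to_Q p) = keys p" by (auto simp: in_keys_iff)
  then show ?thesis
    by (subst op_linear_expand[OF assms, of p]) (simp add: base_change_def to_Q_sum to_Q_scale)
qed

lemma base_change_single [simp]:
  "base_change \<theta> (Poly_Mapping.single m 1) = to_Q (\<theta> (Poly_Mapping.single m 1))"
  by (simp add: base_change_def)

lemma base_change_add: "base_change (\<lambda>p. \<theta> p + \<eta> p) = (\<lambda>p. base_change \<theta> p + base_change \<eta> p)"
  by (simp add: base_change_def fun_eq_iff to_Q_add scale_add_right sum.distrib)

lemma base_change_scale: "base_change (\<lambda>p. scale c (\<theta> p)) = (\<lambda>p. scale (to_fract c) (base_change \<theta> p))"
  by (simp add: base_change_def fun_eq_iff to_Q_scale scale_sum_right mult.commute)

lemma base_change_comp: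
  assumes "\<theta> \<in> J2"
  shows "base_change (\<theta> \<circ> \<eta>) = base_change \<theta> \<circ> base_change \<eta>"
proof
  fix p
  have "(base_change \<theta> \<circ> base_change \<eta>) p =
        (\<Sum>m\<in>keys p. scale (lookup p m) (base_change \<theta> (to_Q (\<eta> (Poly_Mapping.single m 1)))))"
    using base_change_linear[of \<theta>]
    by (simp add: base_change_def[of \<eta>] op_linear_sum) (simp add: op_linear_def)
  then show "base_change (\<theta> \<circ> \<eta>) p = (base_change \<theta> \<circ> base_change \<eta>) p"
    by (simp add: base_change_to_Q[OF J2_linear[OF assms]] base_change_def[of "\<theta> \<circ> \<eta>"])
qed

lemma base_change_inj:
  assumes "\<theta> \<in> J2" "\<eta> \<in> J2" "base_change \<theta> = base_change \<eta>"
  shows "\<theta> = \<eta>"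
  using assms base_change_to_Q J2_linear by (metis ext to_Q_inj)

lemma J2Q_iff:
  "\<sigma> \<in> J2Q \<longleftrightarrow> (\<exists>\<theta>\<in>J2. \<exists>s. s \<noteq> 0 \<and> \<sigma> = (\<lambda>p. scale (1 / to_fract s) (base_change \<theta> p)))"
proof
  assume "\<sigma> \<in> J2Q"
  then show "\<exists>\<theta>\<in>J2. \<exists>s. s \<noteq> 0 \<and> \<sigma> = (\<lambda>p. scale (1 / to_fract s) (base_change \<theta> p))"
  proof (induction rule: J2Q.induct)
    case (base \<theta>)
    then show ?case by (intro bexI[of _ \<theta>] exI[of _ 1]) simp_all
  next
    case (scale \<sigma> c)
    then obtain \<theta> s where *: "\<theta> \<in> J2" "s \<noteq> 0" "\<sigma> = (\<lambda>p. scale (1 / to_fract s) (base_change \<theta> p))"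
      by blast
    obtain a t where t: "c = to_fract a / to_fract t" "t \<noteq> 0"
      by (cases c) (auto simp: Fract_conv_to_fract)
    show ?case
      using * t J2.scale[of \<theta> a]
      by (intro bexI[of _ "\<lambda>p. scale a (\<theta> p)"] exI[of _ "t * s"])
        (simp_all add: base_change_scale)
  next
    case (add \<sigma> \<tau>)
    then obtain \<theta> s \<eta> t where *:
      "\<theta> \<in> J2" "s \<noteq> 0" "\<sigma> = (\<lambda>p. scale (1 / to_fract s) (base_change \<theta> p))"
      "\<eta> \<in> J2" "t \<noteq> 0" "\<tau> = (\<lambda>p. scale (1 / to_fract t) (base_change \<eta> p))"
      by blast
    have "(\<lambda>p. scale t (\<theta> p) + scale s (\<eta> p)) \<in> J2"
      using * by (intro J2.add J2.scale)
    then show ?case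
      using *
      by (intro bexI[of _ "\<lambda>p. scale t (\<theta> p) + scale s (\<eta> p)"] exI[of _ "s * t"])
        (simp_all add: base_change_scale base_change_add scale_add_right)
  qed
qed (auto intro: J2Q.intros)


subsection \<open>A nonzero operator lies in only finitely many powers of the ideal\<close>

definition raises_ge :: "nat \<Rightarrow> ('a::zero mpoly \<Rightarrow> 'b::zero mpoly) \<Rightarrow> bool" where
  "raises_ge k \<theta> \<longleftrightarrow> (\<forall>p d. (\<forall>m\<in>keys p. d \<le> mdeg m) \<longrightarrow> (\<forall>m\<in>keys (\<theta> p). d + k \<le> mdeg m))"

definition raises_le :: "nat \<Rightarrow> ('a::zero mpoly \<Rightarrow> 'b::zero mpoly) \<Rightarrow> bool" where
  "raises_le k \<theta> \<longleftrightarrow> (\<forall>p d. (\<forall>m\<in>keys p. mdeg m \<le> d) \<longrightarrow> (\<forall>m\<in>keys (\<theta> p). mdeg m \<le> d + k))"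

lemma keys_scaleD: "m \<in> keys (scale c p) \<Longrightarrow> m \<in> keys p"
  by (auto simp: in_keys_iff)

lemma keys_to_Q [simp]: "keys (to_Q p) = keys p"
  by (auto simp: in_keys_iff)

lemma keys_addD: "m \<in> keys (p + q) \<Longrightarrow> m \<in> keys p \<or> m \<in> keys q"
  using Poly_Mapping.keys_add[of p q] by blast

lemma keys_sumD:
  fixes f :: "'x \<Rightarrow> 'a::comm_ring_1 mpoly"
  shows "m \<in> keys (sum f A) \<Longrightarrow> \<exists>x\<in>A. m \<in> keys (f x)"
  by (induction A rule: infinite_finite_induct) (auto dest: keys_addD)

lemma keys_Jqk:
  assumes "m \<in> keys (Jqk k p)"
  shows "\<exists>m'\<in>keys p. mdeg m = mdeg m' + k"
proof -
  obtain d where "d \<in> mdeg ` keys p" "m \<in> keys (hpart (d + k) (lookup (Jq (hpart d (lookup p)))))"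
    using assms keys_sumD unfolding Jqk_def by blast
  then show ?thesis
    by (auto simp: in_keys_iff lookup_hpart split: if_splits)
qed

lemma keys_base_change:
  assumes "m \<in> keys (base_change \<theta> p)"
  shows "\<exists>m'\<in>keys p. m \<in> keys (\<theta> (Poly_Mapping.single m' 1))"
  using keys_sumD[OF assms[unfolded base_change_def]] by (auto dest!: keys_scaleD)

lemma raises_Jqk: "raises_ge k (Jqk k)" "raises_le k (Jqk k)"
  unfolding raises_ge_def raises_le_def by (auto dest!: keys_Jqk)

lemma raises_scale:
  "raises_ge k \<theta> \<Longrightarrow> raises_ge k (\<lambda>p. scale c (\<theta> p))"
  "raises_le k \<theta> \<Longrightarrow> raises_le k (\<lambda>p. scale c (\<theta> p))"
  unfolding raises_ge_def raises_le_def by (blast dest: keys_scaleD)+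

lemma raises_ge_mono:
  assumes "raises_ge k \<theta>" "l \<le> k"
  shows "raises_ge l \<theta>"
  unfolding raises_ge_def
proof (intro allI impI ballI)
  fix p d m
  assume "\<forall>m\<in>keys p. d \<le> mdeg m" "m \<in> keys (\<theta> p)"
  then have "d + k \<le> mdeg m" using assms(1) unfolding raises_ge_def by blast
  with assms(2) show "d + l \<le> mdeg m" by simp
qed

lemma raises_le_mono:
  assumes "raises_le k \<theta>" "k \<le> l"
  shows "raises_le l \<theta>"
  unfolding raises_le_def
proof (intro allI impI ballI)
  fix p d m
  assume "\<forall>m\<in>keys p. mdeg m \<le> d" "m \<in> keys (\<theta> p)"
  then have "mdeg m \<le> d + k" using assms(1) unfolding raises_le_def by blast
  with assms(2) show "mdeg m \<le> d + l" by simp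
qed

lemma raises_add:
  "raises_ge k \<theta> \<Longrightarrow> raises_ge k \<eta> \<Longrightarrow> raises_ge k (\<lambda>p. \<theta> p + \<eta> p)"
  "raises_le k \<theta> \<Longrightarrow> raises_le k \<eta> \<Longrightarrow> raises_le k (\<lambda>p. \<theta> p + \<eta> p)"
  unfolding raises_ge_def raises_le_def by (blast dest: keys_addD)+

lemma raises_ge_comp:
  fixes \<theta> :: "'a::zero mpoly \<Rightarrow> 'b::zero mpoly" and \<eta> :: "'c::zero mpoly \<Rightarrow> 'a mpoly"
  assumes "raises_ge k \<theta>" "raises_ge l \<eta>"
  shows "raises_ge (k + l) (\<theta> \<circ> \<eta>)"
  unfolding raises_ge_def
proof (intro allI impI)
  fix p :: "'c mpoly" and d
  assume "\<forall>m\<in>keys p. d \<le> mdeg m"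
  then have "\<forall>m\<in>keys (\<eta> p). d + l \<le> mdeg m"
    using assms(2) unfolding raises_ge_def by blast
  then have "\<forall>m\<in>keys (\<theta> (\<eta> p)). d + l + k \<le> mdeg m"
    using assms(1) unfolding raises_ge_def by blast
  then show "\<forall>m\<in>keys ((\<theta> \<circ> \<eta>) p). d + (k + l) \<le> mdeg m"
    by (simp add: ac_simps)
qed

lemma raises_le_comp:
  fixes \<theta> :: "'a::zero mpoly \<Rightarrow> 'b::zero mpoly" and \<eta> :: "'c::zero mpoly \<Rightarrow> 'a mpoly"
  assumes "raises_le k \<theta>" "raises_le l \<eta>"
  shows "raises_le (k + l) (\<theta> \<circ> \<eta>)"
  unfolding raises_le_def
proof (intro allI impI)
  fix p :: "'c mpoly" and d
  assume "\<forall>m\<in>keys p. mdeg m \<le> d"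
  then have "\<forall>m\<in>keys (\<eta> p). mdeg m \<le> d + l"
    using assms(2) unfolding raises_le_def by blast
  then have "\<forall>m\<in>keys (\<theta> (\<eta> p)). mdeg m \<le> d + l + k"
    using assms(1) unfolding raises_le_def by blast
  then show "\<forall>m\<in>keys ((\<theta> \<circ> \<eta>) p). mdeg m \<le> d + (k + l)"
    by (simp add: ac_simps)
qed

lemma raises_base_change:
  "raises_ge k \<theta> \<Longrightarrow> raises_ge k (base_change \<theta>)"
  "raises_le k \<theta> \<Longrightarrow> raises_le k (base_change \<theta>)"
proof -
  assume *: "raises_ge k \<theta>"
  show "raises_ge k (base_change \<theta>)"
    unfolding raises_ge_def
  proof (intro allI impI ballI)
    fix p d m
    assume p: "\<forall>m\<in>keys p. d \<le> mdeg m" and "m \<in> keys (base_change \<theta> p)"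
    then obtain m' where m': "m' \<in> keys p" "m \<in> keys (\<theta> (Poly_Mapping.single m' 1))"
      using keys_base_change by blast
    have "\<forall>x\<in>keys (Poly_Mapping.single m' (1::dyadic)). d \<le> mdeg x" using p m'(1) by simp
    then show "d + k \<le> mdeg m" using * m'(2) unfolding raises_ge_def by blast
  qed
next
  assume *: "raises_le k \<theta>"
  show "raises_le k (base_change \<theta>)"
    unfolding raises_le_def
  proof (intro allI impI ballI)
    fix p d m
    assume p: "\<forall>m\<in>keys p. mdeg m \<le> d" and "m \<in> keys (base_change \<theta> p)"
    then obtain m' where m': "m' \<in> keys p" "m \<in> keys (\<theta> (Poly_Mapping.single m' 1))"
      using keys_base_change by blast
    have "\<forall>x\<in>keys (Poly_Mapping.single m' (1::dyadic)). mdeg x \<le> d" using p m'(1) by simp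
    then show "mdeg m \<le> d + k" using * m'(2) unfolding raises_le_def by blast
  qed
qed

lemma J2_raises: "\<theta> \<in> J2 \<Longrightarrow> raises_ge 0 \<theta> \<and> (\<exists>D. raises_le D \<theta>)"
proof (induction rule: J2.induct)
  case (gen k)
  show ?case using raises_Jqk raises_ge_mono by blast
next
  case (scale \<theta> c)
  then show ?case using raises_scale by blast
next
  case (add \<theta> \<eta>)
  then obtain D E where "raises_le D \<theta>" "raises_le E \<eta>" by blast
  then have "raises_le (max D E) \<theta>" "raises_le (max D E) \<eta>"
    using raises_le_mono max.cobounded1 max.cobounded2 by blast+
  then show ?case using add raises_add by blast
next
  case (comp \<theta> \<eta>)
  then obtain D E where "raises_le D \<theta>" "raises_le E \<eta>" by blast
  then have "raises_le (D + E) (\<theta> \<circ> \<eta>)" by (rule raises_le_comp)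
  moreover have "raises_ge 0 (\<theta> \<circ> \<eta>)" using raises_ge_comp[of 0 \<theta> 0 \<eta>] comp.IH by simp
  ultimately show ?case by (auto simp: comp_def)
qed

lemma J2Q_linear: "\<sigma> \<in> J2Q \<Longrightarrow> op_linear \<sigma>"
proof (induction rule: J2Q.induct)
  case (base \<theta>)
  show ?case by (rule base_change_linear)
qed (auto simp: op_linear_def scale_add_right ac_simps)

lemma J2Q_raises: "\<sigma> \<in> J2Q \<Longrightarrow> raises_ge 0 \<sigma> \<and> (\<exists>D. raises_le D \<sigma>)"
proof (induction rule: J2Q.induct)
  case (base \<theta>)
  then show ?case using J2_raises raises_base_change by blast
next
  case (scale \<theta> c)
  then show ?case using raises_scale by blast
next
  case (add \<theta> \<eta>)
  then obtain D E where "raises_le D \<theta>" "raises_le E \<eta>" by blast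
  then have "raises_le (max D E) \<theta>" "raises_le (max D E) \<eta>"
    using raises_le_mono max.cobounded1 max.cobounded2 by blast+
  then show ?case using add raises_add by blast
qed

lemma J2plus_raises: "\<sigma> \<in> J2plus \<Longrightarrow> raises_ge 1 \<sigma>"
proof (induction rule: J2plus.induct)
  case gen1
  show ?case by (intro raises_base_change raises_Jqk)
next
  case gen2
  have "raises_ge 1 (Jqk 2)" using raises_Jqk(1)[of 2] by (rule raises_ge_mono) simp
  then show ?case by (rule raises_base_change)
next
  case (add \<theta> \<eta>)
  then show ?case by (intro raises_add)
next
  case (left \<alpha> \<theta>)
  then show ?case using raises_ge_comp[of 0 \<alpha> 1 \<theta>] J2Q_raises by (simp add: comp_def)
next
  case (right \<theta> \<alpha>)
  then show ?case using raises_ge_comp[of 1 \<theta> 0 \<alpha>] J2Q_raises by (simp add: comp_def)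
qed

lemma J2plus_power_raises: "\<sigma> \<in> J2plus_power j \<Longrightarrow> raises_ge j \<sigma>"
proof (induction j arbitrary: \<sigma>)
  case 0
  then show ?case using J2Q_raises by simp
next
  case (Suc j)
  from Suc.prems have "\<sigma> \<in> ideal_mult (J2plus_power j) J2plus" by simp
  then show ?case
  proof (induction rule: ideal_mult.induct)
    case zero
    show ?case by (simp add: raises_ge_def)
  next
    case (prod \<theta> \<eta>)
    then show ?case using raises_ge_comp[OF Suc.IH J2plus_raises] by (simp add: comp_def)
  next
    case (add \<theta> \<eta>)
    then show ?case by (intro raises_add)
  qed
qed

lemma J2plus_power_bounded:
  assumes "\<sigma> \<in> J2Q" "\<sigma> \<noteq> (\<lambda>_. 0)"
  shows "\<exists>b. \<forall>j. \<sigma> \<in> J2plus_power j \<longrightarrow> j \<le> b"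
proof -
  obtain D where D: "raises_le D \<sigma>" using J2Q_raises assms(1) by blast
  have "j \<le> D" if j: "\<sigma> \<in> J2plus_power j" for j
  proof (rule ccontr)
    assume "\<not> j \<le> D"
    have "keys (\<sigma> (Poly_Mapping.single m 1)) = {}" for m
    proof (rule ccontr)
      assume "keys (\<sigma> (Poly_Mapping.single m 1)) \<noteq> {}"
      then obtain x where x: "x \<in> keys (\<sigma> (Poly_Mapping.single m 1))" by blast
      have "\<forall>y\<in>keys (Poly_Mapping.single m (1::dyadic fract)). mdeg m \<le> mdeg y \<and> mdeg y \<le> mdeg m"
        by simp
      then have "mdeg m + j \<le> mdeg x" "mdeg x \<le> mdeg m + D"
        using x D J2plus_power_raises[OF j] unfolding raises_ge_def raises_le_def by blast+
      with \<open>\<not> j \<le> D\<close> show False by simp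
    qed
    then have "\<sigma> (Poly_Mapping.single m 1) = 0" for m
      by (metis empty_iff in_keys_iff lookup_zero poly_mapping_eqI)
    then have "\<sigma> p = 0" for p
      using op_linear_expand[OF J2Q_linear[OF assms(1)], of p] by simp
    with assms(2) show False by auto
  qed
  then show ?thesis by blast
qed

end

(*
  Let D_r be the derivation with D_r(xi_i) = xi_i^(r+1); D_0 multiplies a homogeneous element by its
  degree. Comparing values on the generators gives
    [D_0, Jq] = sum over j of (-2)^j D_(j+1) Jq,
  both sides being derivations along Jq, and hence Newton's identity
    k Jq^k = sum over j < k of (-2)^j D_(j+1) Jq^(k-1-j).
  It yields D_1 = Jq^1 and 2 D_2 = Jq^1 Jq^1 - 2 Jq^2, and then (r-1) D_(r+1) = [D_1, D_r] puts every
  D_r with r > 0 in the rational ideal generated by Jq^1 and Jq^2. By Newton's identity again, so is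
  every Jq^k with k > 0. Conversely, modulo hit elements an operator in J2 acts on power series as
  multiplication by a constant, which vanishes for operators of norm less than 1 since these raise
  degrees.
*)

theory Submission
  imports Defs
begin

section \<open>Linear operators and twisted derivations\<close>

abbreviation mon :: "mono \<Rightarrow> dyadic mpoly" where
  "mon m \<equiv> Poly_Mapping.single m 1"

lemma op_linear_eqI:
  assumes "op_linear A" "op_linear B" "\<And>m. A (Poly_Mapping.single m 1) = B (Poly_Mapping.single m 1)"
  shows "A = B"
proof
  fix p
  show "A p = B p"
    unfolding op_linear_expand[OF assms(1), of p] op_linear_expand[OF assms(2), of p] assms(3) ..
qed

lemma op_linear_zero_arg: "op_linear A \<Longrightarrow> A 0 = 0"
  using op_linear_sum[of A id "{}"] by simp

lemma scale_diff: "scale c (p - q) = scale c p - scale c q"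
  by (rule poly_mapping_eqI) (simp add: lookup_minus algebra_simps)

lemma op_linear_id: "op_linear (\<lambda>p. p)"
  and op_linear_add: "op_linear A \<Longrightarrow> op_linear B \<Longrightarrow> op_linear (\<lambda>p. A p + B p)"
  and op_linear_minus: "op_linear A \<Longrightarrow> op_linear B \<Longrightarrow> op_linear (\<lambda>p. A p - B p)"
  and op_linear_scale: "op_linear A \<Longrightarrow> op_linear (\<lambda>p. scale c (A p))"
  and op_linear_comp: "op_linear A \<Longrightarrow> op_linear B \<Longrightarrow> op_linear (\<lambda>p. A (B p))"
  and op_linear_mult_left: "op_linear A \<Longrightarrow> op_linear (\<lambda>p. q * A p)"
  and op_linear_mult_right: "op_linear A \<Longrightarrow> op_linear (\<lambda>p. A p * q)"
  by (auto simp: op_linear_def scale_add_right scale_diff scale_mult_left scale_mult_right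
      algebra_simps)

lemma op_linear_sum_ops:
  assumes "\<And>j. j \<in> I \<Longrightarrow> op_linear (A j)"
  shows "op_linear (\<lambda>p. \<Sum>j\<in>I. A j p)"
  using assms by (auto simp: op_linear_def scale_sum_right sum.distrib)

lemma op_linear_Jq: "op_linear Jq"
  by (simp add: op_linear_def Jq_add Jq_scale)

lemma op_linear_hpart: "op_linear (\<lambda>p. hpart d (lookup p))"
  by (simp add: op_linear_def hpart_add hpart_scale)

text \<open>Both sides are bilinear in \<open>p\<close> and \<open>q\<close>, so the rule extends
  from pairs of monomials one argument at a time.\<close>

lemma mult_op_eqI:
  assumes "op_linear A" "op_linear \<sigma>" "op_linear \<tau>"
    and "\<And>a b. A (mon (a + b)) = A (mon a) * \<sigma> (mon b) + \<tau> (mon a) * A (mon b)"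
  shows "A (p * q) = A p * \<sigma> q + \<tau> p * A q"
proof -
  have 1: "(\<lambda>p. A (p * mon b)) = (\<lambda>p. A p * \<sigma> (mon b) + \<tau> p * A (mon b))" for b
  proof (rule op_linear_eqI)
    show "op_linear (\<lambda>p. A (p * mon b))"
      by (rule op_linear_comp[OF assms(1) op_linear_mult_right[OF op_linear_id]])
    show "op_linear (\<lambda>p. A p * \<sigma> (mon b) + \<tau> p * A (mon b))"
      using assms by (intro op_linear_add op_linear_mult_right)
  qed (simp add: mult_single assms(4))
  have "(\<lambda>q. A (p * q)) = (\<lambda>q. A p * \<sigma> q + \<tau> p * A q)"
  proof (rule op_linear_eqI)
    show "op_linear (\<lambda>q. A (p * q))"
      by (rule op_linear_comp[OF assms(1) op_linear_mult_left[OF op_linear_id]])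
    show "op_linear (\<lambda>q. A p * \<sigma> q + \<tau> p * A q)"
      using assms by (intro op_linear_add op_linear_mult_left)
  qed (rule fun_cong[OF 1])
  then show ?thesis by meson
qed

text \<open>With \<open>\<sigma>\<close> the identity this is an ordinary derivation; with
  \<open>\<sigma> = Jq\<close> it covers a derivation composed with \<open>Jq\<close> on either
  side, so that both halves of a commutator with \<open>Jq\<close> can be compared on
  generators.\<close>

definition twisted_derivation ::
  "(dyadic mpoly \<Rightarrow> dyadic mpoly) \<Rightarrow> (dyadic mpoly \<Rightarrow> dyadic mpoly) \<Rightarrow> bool" where
  "twisted_derivation \<sigma> A \<longleftrightarrow> op_linear A \<and> (\<forall>p q. A (p * q) = A p * \<sigma> q + \<sigma> p * A q)"

lemma twisted_derivation_minus:
  "twisted_derivation \<sigma> A \<Longrightarrow> twisted_derivation \<sigma> B \<Longrightarrow> twisted_derivation \<sigma> (\<lambda>p. A p - B p)"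
  unfolding twisted_derivation_def by (auto intro: op_linear_minus simp: algebra_simps)

lemma twisted_derivation_scale:
  "twisted_derivation \<sigma> A \<Longrightarrow> twisted_derivation \<sigma> (\<lambda>p. scale c (A p))"
  unfolding twisted_derivation_def
  by (auto intro: op_linear_scale simp: scale_add_right scale_mult_left scale_mult_right)

lemma twisted_derivation_sum:
  assumes "\<And>j. j \<in> I \<Longrightarrow> twisted_derivation \<sigma> (A j)"
  shows "twisted_derivation \<sigma> (\<lambda>p. \<Sum>j\<in>I. A j p)"
  using assms unfolding twisted_derivation_def
  by (auto intro: op_linear_sum_ops simp: sum.distrib sum_distrib_left sum_distrib_right)


section \<open>Degrees of monomials\<close>

lemma mdeg_superset:
  assumes "finite A" "keys m \<subseteq> A"
  shows "mdeg m = (\<Sum>i\<in>A. lookup m i)"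
  unfolding mdeg_def using assms by (intro sum.mono_neutral_left) (auto simp: in_keys_iff)

lemma mdeg_add: "mdeg (a + b) = mdeg a + mdeg b"
proof -
  let ?A = "keys a \<union> keys b"
  show ?thesis
    using mdeg_superset[of ?A "a + b"] mdeg_superset[of ?A a] mdeg_superset[of ?A b]
      Poly_Mapping.keys_add[of a b]
    by (simp add: lookup_add sum.distrib)
qed

lemma mdeg_zero [simp]: "mdeg 0 = 0"
  by (simp add: mdeg_def)

lemma mdeg_single [simp]: "mdeg (Poly_Mapping.single i k) = k"
  by (simp add: mdeg_def)

lemma mdeg_eq_0_iff: "mdeg m = 0 \<longleftrightarrow> m = 0"
proof
  assume "mdeg m = 0"
  then show "m = 0" by (intro poly_mapping_eqI) (auto simp: mdeg_def in_keys_iff)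
qed simp

text \<open>Removing one variable lowers the total degree by one. This induction carries facts about
  the generators \<open>X i\<close> to all monomials.\<close>

lemma mono_induct [case_names zero add]:
  assumes "P 0" "\<And>m i. P m \<Longrightarrow> P (m + Poly_Mapping.single i 1)"
  shows "P (m :: mono)"
proof (induction "mdeg m" arbitrary: m)
  case 0
  then show ?case using assms(1) mdeg_eq_0_iff by metis
next
  case (Suc d)
  then obtain i where i: "lookup m i \<noteq> 0"
    by (metis mdeg_zero nat.distinct(1) poly_mapping_eqI lookup_zero)
  define m' where "m' = m - Poly_Mapping.single i 1"
  have m: "m = m' + Poly_Mapping.single i 1"
    using i by (intro poly_mapping_eqI) (auto simp: m'_def lookup_add lookup_minus lookup_single when_def)
  then have "mdeg m = Suc (mdeg m')" by (simp add: mdeg_add)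
  then have "P m'" using Suc by simp
  then show ?case using assms(2) m by metis
qed

lemma X_power: "X i ^ k = mon (Poly_Mapping.single i k)"
proof (induction k)
  case (Suc k)
  then show ?case by (simp add: X_def mult_single flip: single_add)
qed simp

section \<open>The filtration by powers of the ideal generated by the variables\<close>

definition order_ge :: "nat \<Rightarrow> dyadic mpoly \<Rightarrow> bool" where
  "order_ge d p \<longleftrightarrow> (\<forall>m\<in>keys p. d \<le> mdeg m)"

lemma order_ge_zero [simp]: "order_ge d 0"
  by (simp add: order_ge_def)

lemma order_ge_add: "order_ge d p \<Longrightarrow> order_ge d q \<Longrightarrow> order_ge d (p + q)"
  unfolding order_ge_def by (auto dest!: keys_addD)

lemma order_ge_scale: "order_ge d p \<Longrightarrow> order_ge d (scale c p)"
  unfolding order_ge_def using keys_scaleD by blast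

lemma order_ge_mon: "d \<le> mdeg m \<Longrightarrow> order_ge d (mon m)"
  by (simp add: order_ge_def)

lemma keys_multD:
  assumes "m \<in> keys (p * q :: dyadic mpoly)"
  shows "\<exists>a\<in>keys p. \<exists>b\<in>keys q. m = a + b"
  using assms keys_mult[of p q] by blast

lemma order_ge_mult: "order_ge d p \<Longrightarrow> order_ge e q \<Longrightarrow> order_ge (d + e) (p * q)"
  unfolding order_ge_def by (auto dest!: keys_multD simp: mdeg_add add_mono)

text \<open>Each factor \<open>X i\<close> is replaced by \<open>X i + X i ^ 2\<close>, which has no
  constant term and brings in no other variable.\<close>

lemma keys_Jq_mon: "x \<in> keys (Jq (mon m)) \<Longrightarrow> mdeg m \<le> mdeg x \<and> keys x \<subseteq> keys m"
proof (induction m arbitrary: x rule: mono_induct)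
  case zero
  then show ?case by (simp add: Jq_one)
next
  case (add m i)
  have J: "Jq (mon (Poly_Mapping.single i 1)) = mon (Poly_Mapping.single i 1) + mon (Poly_Mapping.single i 2)"
    using Jq_X[of i] X_power[of i 1] X_power[of i 2] by simp
  obtain a b where ab: "a \<in> keys (Jq (mon m))" "x = a + b"
    "b = Poly_Mapping.single i 1 \<or> b = Poly_Mapping.single i 2"
    using add.prems unfolding Jq_single_add J by (auto dest!: keys_multD keys_addD split: if_splits)
  have "keys (m + Poly_Mapping.single i 1) = insert i (keys m)"
    by (auto simp: in_keys_iff lookup_add lookup_single when_def split: if_splits)
  moreover have "keys x \<subseteq> keys a \<union> keys b" unfolding ab(2) by (rule Poly_Mapping.keys_add)
  moreover have "keys b = {i}" using ab(3) by auto
  ultimately show ?case using ab add.IH[OF ab(1)] by (auto simp: mdeg_add)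
qed

lemma twisted_derivation_one:
  assumes "twisted_derivation \<sigma> A" "\<sigma> 1 = 1"
  shows "A 1 = 0"
proof -
  have "A (1 * 1) = A 1 * \<sigma> 1 + \<sigma> 1 * A 1" using assms(1) unfolding twisted_derivation_def by blast
  then have "A 1 = A 1 + A 1" using assms(2) by (simp only: mult_1 mult_1_right)
  then show ?thesis by (simp only: add_cancel_right_right)
qed

text \<open>Every Leibniz term contains \<open>A\<close> exactly once and gains its surplus
  \<open>k\<close> there, while \<open>\<sigma>\<close> loses no degree.\<close>

lemma twisted_derivation_order:
  assumes "twisted_derivation \<sigma> A" "\<sigma> 1 = 1" "\<And>m. order_ge (mdeg m) (\<sigma> (mon m))"
    and "\<And>i. order_ge (Suc k) (A (X i))"
  shows "order_ge (mdeg m + k) (A (mon m))"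
proof (induction m rule: mono_induct)
  case zero
  show ?case using twisted_derivation_one[OF assms(1,2)] by simp
next
  case (add m i)
  have "mon (m + Poly_Mapping.single i 1) = mon m * X i"
    by (simp add: X_def mult_single)
  then have "A (mon (m + Poly_Mapping.single i 1)) = A (mon m) * \<sigma> (X i) + \<sigma> (mon m) * A (X i)"
    using assms(1) unfolding twisted_derivation_def by simp
  moreover have "order_ge 1 (\<sigma> (X i))"
    using assms(3)[of "Poly_Mapping.single i 1"] by (simp add: X_def)
  then have "order_ge (mdeg m + k + 1) (A (mon m) * \<sigma> (X i))"
    by (rule order_ge_mult[OF add])
  moreover have "order_ge (mdeg m + k + 1) (\<sigma> (mon m) * A (X i))"
    using order_ge_mult[OF assms(3) assms(4)] by simp
  ultimately show ?case
    using order_ge_add by (simp add: mdeg_add)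
qed

lemma twisted_derivation_eqI:
  assumes "twisted_derivation \<sigma> A" "twisted_derivation \<sigma> B" "\<sigma> 1 = 1" "\<And>i. A (X i) = B (X i)"
  shows "A = B"
proof (rule op_linear_eqI)
  show "op_linear A" "op_linear B" using assms by (simp_all add: twisted_derivation_def)
  show "A (mon m) = B (mon m)" for m
  proof (induction m rule: mono_induct)
    case zero
    show ?case
      using twisted_derivation_one[OF assms(1,3)] twisted_derivation_one[OF assms(2,3)] by simp
  next
    case (add m i)
    have "mon (m + Poly_Mapping.single i 1) = mon m * X i"
      by (simp add: X_def mult_single)
    then show ?case using assms add unfolding twisted_derivation_def by simp
  qed
qed


section \<open>The vector fields \<open>\<Sum>\<^sub>i \<xi>\<^sub>i\<^sup>r\<^sup>+\<^sup>1 \<partial>\<^sub>i\<close>\<close>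

text \<open>Differentiating by one variable and multiplying by its power \<open>r + 1\<close>
  amounts to multiplying the monomial by its exponent and the \<open>r\<close>-th power of that
  variable, so no exponent has to be lowered.\<close>

definition vfield :: "nat \<Rightarrow> dyadic mpoly \<Rightarrow> dyadic mpoly" where
  "vfield r p = (\<Sum>m\<in>keys p. scale (lookup p m)
     (\<Sum>i\<in>keys m. scale (of_nat (lookup m i)) (mon (m + Poly_Mapping.single i r))))"

lemma vfield_linear: "op_linear (vfield r)"
  unfolding op_linear_def vfield_def by (intro conjI allI sum_keys_add sum_keys_scale)

lemma vfield_mon:
  "vfield r (mon m) = (\<Sum>i\<in>keys m. scale (of_nat (lookup m i)) (mon (m + Poly_Mapping.single i r)))"
  by (simp add: vfield_def)

lemma vfield_mon_superset:
  assumes "finite A" "keys m \<subseteq> A"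
  shows "vfield r (mon m) = (\<Sum>i\<in>A. scale (of_nat (lookup m i)) (mon (m + Poly_Mapping.single i r)))"
  unfolding vfield_mon using assms by (intro sum.mono_neutral_left) (auto simp: in_keys_iff)

lemma vfield_mult: "vfield r (p * q) = vfield r p * q + p * vfield r q"
proof (rule mult_op_eqI)
  fix a b :: mono
  let ?A = "keys a \<union> keys b"
  have k: "keys (a + b) \<subseteq> ?A" by (rule Poly_Mapping.keys_add)
  show "vfield r (mon (a + b)) = vfield r (mon a) * mon b + mon a * vfield r (mon b)"
    using vfield_mon_superset[OF _ k] vfield_mon_superset[of ?A a] vfield_mon_superset[of ?A b]
    by (simp add: sum_distrib_left sum_distrib_right scale_mult_left scale_mult_right mult_single
        lookup_add scale_add_left sum.distrib ac_simps)
qed (rule vfield_linear op_linear_id)+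

lemma vfield_derivation: "twisted_derivation (\<lambda>p. p) (vfield r)"
  by (simp add: twisted_derivation_def vfield_linear vfield_mult)

lemma vfield_X_power: "vfield r (X i ^ k) = scale (of_nat k) (X i ^ (k + r))"
  unfolding X_power by (cases "k = 0") (simp_all add: vfield_mon[of _ 0, simplified] vfield_mon flip: single_add)

lemma vfield_X: "vfield r (X i) = X i ^ Suc r"
  using vfield_X_power[of r i 1] by simp

lemma hpart_mon: "hpart e (lookup (mon m)) = (if mdeg m = e then mon m else 0)"
  by (rule poly_mapping_eqI) (auto simp: lookup_hpart lookup_single when_def)

text \<open>Each term multiplies a monomial by an \<open>r\<close>-th power of a variable, so the
  field is homogeneous of degree \<open>r\<close>.\<close>

lemma hpart_vfield: "hpart (e + r) (lookup (vfield r p)) = vfield r (hpart e (lookup p))"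
proof -
  have "(\<lambda>p. hpart (e + r) (lookup (vfield r p))) = (\<lambda>p. vfield r (hpart e (lookup p)))"
  proof (rule op_linear_eqI)
    show "op_linear (\<lambda>p. hpart (e + r) (lookup (vfield r p)))"
      by (rule op_linear_comp[OF op_linear_hpart vfield_linear])
    show "op_linear (\<lambda>p. vfield r (hpart e (lookup p)))"
      by (rule op_linear_comp[OF vfield_linear op_linear_hpart])
    show "hpart (e + r) (lookup (vfield r (mon m))) = vfield r (hpart e (lookup (mon m)))" for m
      unfolding vfield_mon op_linear_sum[OF op_linear_hpart] hpart_scale hpart_mon
      by (simp add: mdeg_add vfield_mon op_linear_zero_arg[OF vfield_linear])
  qed
  then show ?thesis by meson
qed

lemma scale_sum_left: "scale (sum f A) p = (\<Sum>x\<in>A. scale (f x) p)"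
  by (rule poly_mapping_eqI) (simp add: lookup_sum sum_distrib_right)

text \<open>Euler's identity for homogeneous polynomials.\<close>

lemma vfield_0_mon: "vfield 0 (mon m) = scale (of_nat (mdeg m)) (mon m)"
  by (simp add: vfield_mon mdeg_def scale_sum_left)

lemma vfield_0_hpart: "vfield 0 (hpart e (lookup p)) = scale (of_nat e) (hpart e (lookup p))"
proof -
  have "(\<lambda>p. vfield 0 (hpart e (lookup p))) = (\<lambda>p. scale (of_nat e) (hpart e (lookup p)))"
  proof (rule op_linear_eqI)
    show "op_linear (\<lambda>p. vfield 0 (hpart e (lookup p)))"
      by (rule op_linear_comp[OF vfield_linear op_linear_hpart])
    show "op_linear (\<lambda>p. scale (of_nat e) (hpart e (lookup p)))"
      by (rule op_linear_scale[OF op_linear_hpart])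
    show "vfield 0 (hpart e (lookup (mon m))) = scale (of_nat e) (hpart e (lookup (mon m)))" for m
      by (simp add: hpart_mon vfield_0_mon op_linear_zero_arg[OF vfield_linear])
  qed
  then show ?thesis by meson
qed

text \<open>The bracket relation of the Witt algebra. On a variable the two composites give
  coefficients \<open>r + 1\<close> and 2 of the same power, whose difference is
  \<open>r - 1\<close>.\<close>

lemma vfield_commutator:
  assumes "r \<ge> 1"
  shows "scale (of_nat (r - 1)) (vfield (Suc r) p) = vfield 1 (vfield r p) - vfield r (vfield 1 p)"
proof -
  have "(\<lambda>p. scale (of_nat (r - 1)) (vfield (Suc r) p)) = (\<lambda>p. vfield 1 (vfield r p) - vfield r (vfield 1 p))"
  proof (rule twisted_derivation_eqI)
    show "twisted_derivation (\<lambda>p. p) (\<lambda>p. scale (of_nat (r - 1)) (vfield (Suc r) p))"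
      by (rule twisted_derivation_scale[OF vfield_derivation])
    show "twisted_derivation (\<lambda>p. p) (\<lambda>p. vfield 1 (vfield r p) - vfield r (vfield 1 p))"
    proof -
      \<comment> \<open>The mixed terms are symmetric in \<open>s\<close> and \<open>t\<close>, so
        they cancel in the commutator and leave a derivation.\<close>
      have "vfield s (vfield t (p * q)) =
        vfield s (vfield t p) * q + vfield t p * vfield s q + (vfield s p * vfield t q + p * vfield s (vfield t q))"
        for s t p q
        using vfield_linear[of s] by (simp only: vfield_mult op_linear_def)
      then show ?thesis
        unfolding twisted_derivation_def
        by (intro conjI allI op_linear_minus op_linear_comp[OF vfield_linear vfield_linear])
          (simp only:, simp only: left_diff_distrib right_diff_distrib, simp)
    qed
    show "scale (of_nat (r - 1)) (vfield (Suc r) (X i)) = vfield 1 (vfield r (X i)) - vfield r (vfield 1 (X i))" for i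
    proof (rule poly_mapping_eqI)
      fix m
      obtain s where "r = Suc s" using assms by (cases r) auto
      then show "lookup (scale (of_nat (r - 1)) (vfield (Suc r) (X i))) m =
          lookup (vfield 1 (vfield r (X i)) - vfield r (vfield 1 (X i))) m"
        unfolding vfield_X vfield_X_power lookup_minus lookup_scale
        by (simp add: algebra_simps)
    qed
  qed simp
  then show ?thesis by meson
qed


section \<open>Newton's identity for the dyadic squares\<close>

lemma hpart_diff: "hpart d (lookup (p - q)) = hpart d (lookup p) - hpart d (lookup (q :: dyadic mpoly))"
  by (rule poly_mapping_eqI) (simp add: lookup_hpart lookup_minus)

lemma hpart_eq_0:
  assumes "order_ge e p" "d < e"
  shows "hpart d (lookup p) = 0"
  using assms by (intro poly_mapping_eqI) (force simp: lookup_hpart order_ge_def in_keys_iff)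

lemma Jqk_mon: "Jqk k (mon m) = hpart (mdeg m + k) (lookup (Jq (mon m)))"
  by (simp add: Jqk_def hpart_mon)

lemma order_Jq_mon: "order_ge (mdeg m) (Jq (mon m))"
  unfolding order_ge_def using keys_Jq_mon by blast

lemma order_Jq_mon_minus: "order_ge (Suc (mdeg m)) (Jq (mon m) - mon m)"
proof (induction m rule: mono_induct)
  case zero
  show ?case by (simp add: Jq_one)
next
  case (add m i)
  have m: "mon (m + Poly_Mapping.single i 1) = mon m * X i"
    by (simp add: X_def mult_single)
  \<comment> \<open>The error splits into the old error times \<open>Jq (X i)\<close>, and
    \<open>mon m\<close> times the error \<open>X i ^ 2\<close> on the new variable.\<close>
  have 1: "Jq (mon m * X i) - mon m * X i = (Jq (mon m) - mon m) * Jq (X i) + mon m * X i ^ 2"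
    by (simp add: Jq_mult Jq_X algebra_simps)
  have "order_ge 1 (Jq (X i))"
    using order_Jq_mon[of "Poly_Mapping.single i 1"] by (simp add: X_def)
  then have "order_ge (Suc (mdeg m) + 1) ((Jq (mon m) - mon m) * Jq (X i))"
    by (rule order_ge_mult[OF add])
  moreover have "order_ge (mdeg m + 2) (mon m * X i ^ 2)"
    unfolding X_power by (intro order_ge_mult order_ge_mon) simp_all
  ultimately show ?case
    unfolding m 1 using order_ge_add by (simp add: mdeg_add)
qed

lemma Jqk_0: "Jqk 0 = (\<lambda>p. p)"
proof (rule op_linear_eqI[OF Jqk_linear op_linear_id])
  fix m
  have "hpart (mdeg m) (lookup (Jq (mon m) - mon m)) = 0"
    by (rule hpart_eq_0[OF order_Jq_mon_minus]) simp
  then show "Jqk 0 (mon m) = mon m"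
    by (simp add: Jqk_mon hpart_diff hpart_mon)
qed

lemma vfield_Jq_derivation: "twisted_derivation Jq (\<lambda>p. vfield r (Jq p))"
  using op_linear_comp[OF vfield_linear op_linear_Jq]
  by (simp add: twisted_derivation_def Jq_mult vfield_mult)

lemma Jq_vfield_derivation: "twisted_derivation Jq (\<lambda>p. Jq (vfield r p))"
  using op_linear_comp[OF op_linear_Jq vfield_linear]
  by (simp add: twisted_derivation_def vfield_mult Jq_mult Jq_add)

lemma vfield_Jq_X: "vfield r (Jq (X i)) = X i ^ Suc r + scale 2 (X i ^ (r + 2))"
  using vfield_linear vfield_X vfield_X_power[of r i 2]
  by (simp add: Jq_X op_linear_def add.commute)

text \<open>The full series of fields applied to \<open>Jq p\<close> need not be a polynomial, so it
  is cut after \<open>k\<close> terms and the remainder is controlled by its order.\<close>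

definition newton_rest :: "nat \<Rightarrow> dyadic mpoly \<Rightarrow> dyadic mpoly" where
  "newton_rest k p = vfield 0 (Jq p) - Jq (vfield 0 p)
     - (\<Sum>j<k. scale ((-2) ^ j) (vfield (Suc j) (Jq p)))"

lemma newton_rest_derivation: "twisted_derivation Jq (newton_rest k)"
  unfolding newton_rest_def
  by (intro twisted_derivation_minus twisted_derivation_sum twisted_derivation_scale
      vfield_Jq_derivation Jq_vfield_derivation)

text \<open>The commutator takes a variable x to x^2, and field number k+1 takes \<open>Jq\<close>
  of x to x^(k+2) + 2 x^(k+3). Subtracting (-2)^k times the latter cancels the current remainder and
  leaves the next one: this is the geometric series of 1/(1+2x), the source of the powers of
  -2.\<close>

lemma newton_rest_X: "newton_rest k (X i) = scale ((-2) ^ k) (X i ^ (k + 2))"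
proof (induction k)
  case 0
  show ?case
    by (rule poly_mapping_eqI)
      (simp only: newton_rest_def vfield_Jq_X, simp add: vfield_X Jq_X lookup_add lookup_minus power2_eq_square)
next
  case (Suc k)
  have "newton_rest (Suc k) (X i) = newton_rest k (X i) - scale ((-2) ^ k) (vfield (Suc k) (Jq (X i)))"
    by (simp add: newton_rest_def)
  then show ?case
    unfolding Suc vfield_Jq_X
    by (simp add: poly_mapping_eq_iff fun_eq_iff lookup_add lookup_minus distrib_left)
qed

text \<open>A raise by at least \<open>k + 1\<close> leaves nothing in the component raised by
  \<open>k\<close>, the one that defines \<open>Jqk k\<close>.\<close>

lemma newton_rest_order: "order_ge (mdeg m + Suc k) (newton_rest k (mon m))"
proof (rule twisted_derivation_order[OF newton_rest_derivation Jq_one order_Jq_mon])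
  show "order_ge (Suc (Suc k)) (newton_rest k (X i))" for i
    unfolding newton_rest_X X_power by (intro order_ge_scale order_ge_mon) simp
qed

text \<open>On a monomial of degree d, take the component of degree d+k of
  \<open>newton_rest k\<close>, which is zero. The Euler field contributes the factor d+k after
  \<open>Jq\<close> and d before it, hence k in the difference.\<close>

lemma Jqk_newton:
  "scale (of_nat k) (Jqk k p) = (\<Sum>j<k. scale ((-2) ^ j) (vfield (Suc j) (Jqk (k - 1 - j) p)))"
proof -
  have "(\<lambda>p. scale (of_nat k) (Jqk k p)) =
        (\<lambda>p. \<Sum>j<k. scale ((-2) ^ j) (vfield (Suc j) (Jqk (k - 1 - j) p)))"
  proof (rule op_linear_eqI)
    show "op_linear (\<lambda>p. scale (of_nat k) (Jqk k p))"
      by (intro op_linear_scale Jqk_linear)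
    show "op_linear (\<lambda>p. \<Sum>j<k. scale ((-2) ^ j) (vfield (Suc j) (Jqk (k - 1 - j) p)))"
      by (intro op_linear_sum_ops op_linear_scale op_linear_comp[OF vfield_linear Jqk_linear])
    fix m
    let ?d = "mdeg m" and ?J = "Jq (mon m)"
    \<comment> \<open>The field itself raises degree by \<open>j + 1\<close>, so only the raise
      \<open>k - 1 - j\<close> is left to the square.\<close>
    have V: "hpart (?d + k) (lookup (vfield (Suc j) ?J)) = vfield (Suc j) (Jqk (k - 1 - j) (mon m))"
      if "j < k" for j
      using hpart_vfield[of "?d + (k - 1 - j)" "Suc j" ?J] that by (simp add: Jqk_mon)
    have "Jq (vfield 0 (mon m)) = scale (of_nat ?d) ?J"
      by (simp add: vfield_0_mon Jq_scale)
    moreover have "hpart (?d + k) (lookup (vfield 0 ?J)) = scale (of_nat (?d + k)) (Jqk k (mon m))"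
      using hpart_vfield[of "?d + k" 0 ?J] vfield_0_hpart[of "?d + k" ?J] by (simp add: Jqk_mon)
    moreover have "hpart (?d + k) (lookup (\<Sum>j<k. scale ((-2) ^ j) (vfield (Suc j) ?J))) =
        (\<Sum>j<k. scale ((-2) ^ j) (vfield (Suc j) (Jqk (k - 1 - j) (mon m))))"
      unfolding op_linear_sum[OF op_linear_hpart] hpart_scale using V by simp
    ultimately have "hpart (?d + k) (lookup (newton_rest k (mon m))) =
        scale (of_nat (?d + k)) (Jqk k (mon m)) - scale (of_nat ?d) (Jqk k (mon m)) -
        (\<Sum>j<k. scale ((-2) ^ j) (vfield (Suc j) (Jqk (k - 1 - j) (mon m))))"
      unfolding newton_rest_def hpart_diff by (simp add: hpart_scale Jqk_mon)
    moreover have "hpart (?d + k) (lookup (newton_rest k (mon m))) = 0"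
      by (rule hpart_eq_0[OF newton_rest_order]) simp
    ultimately show "scale (of_nat k) (Jqk k (mon m)) =
        (\<Sum>j<k. scale ((-2) ^ j) (vfield (Suc j) (Jqk (k - 1 - j) (mon m))))"
      by (simp add: scale_add_left)
  qed
  then show ?thesis by meson
qed


section \<open>The squares of positive degree lie in the augmentation ideal\<close>

lemma residue_of_nat: "residue (of_nat k) j = int k mod 2 ^ j"
  by (induction k) (simp_all add: zero_dyadic.rep_eq one_dyadic.rep_eq plus_dyadic.rep_eq mod_simps ac_simps)

text \<open>Since \<open>k < 2 ^ k\<close>, the residue of \<open>k\<close> modulo
  \<open>2 ^ k\<close> is \<open>k\<close> itself.\<close>

lemma of_nat_dyadic_neq_0: "k > 0 \<Longrightarrow> (of_nat k :: dyadic) \<noteq> 0"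
proof
  assume "k > 0" "(of_nat k :: dyadic) = 0"
  then have "int k mod 2 ^ k = 0"
    using residue_of_nat[of k k] by (simp add: zero_dyadic.rep_eq)
  moreover have "int k < 2 ^ k" by simp
  ultimately show False using \<open>k > 0\<close> by simp
qed

section \<open>Base change and membership in the rational ideal\<close>

lemma id_in_J2: "(\<lambda>p. p) \<in> J2"
  using J2.gen[of 0] by (simp add: Jqk_0)

lemma base_change_id: "base_change (\<lambda>p. p) = (\<lambda>p. p)"
proof
  fix p
  show "base_change (\<lambda>p. p) p = p"
    unfolding base_change_def to_Q_single to_fract_1 by (rule poly_expand[symmetric])
qed

lemma scale_in_J2Q: "(\<lambda>p. scale c p) \<in> J2Q"
  using J2Q.scale[OF J2Q.base[OF id_in_J2]] by (simp add: base_change_id)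

text \<open>Scalar multiples of the identity belong to the rational algebra, so closure under
  scalars is a case of left multiplication.\<close>

lemma J2plus_scale: "\<theta> \<in> J2plus \<Longrightarrow> (\<lambda>p. scale c (\<theta> p)) \<in> J2plus"
  using J2plus.left[OF scale_in_J2Q[of c]] by (simp add: comp_def)

text \<open>This form serves composites whose outer operator is a vector field, known here only to
  be linear.\<close>

lemma base_change_comp_linear:
  assumes "op_linear \<theta>"
  shows "base_change (\<lambda>p. \<theta> (\<eta> p)) = base_change \<theta> \<circ> base_change \<eta>"
proof
  fix p
  show "base_change (\<lambda>p. \<theta> (\<eta> p)) p = (base_change \<theta> \<circ> base_change \<eta>) p"
    using base_change_linear[of \<theta>]
    by (simp add: base_change_def[of \<eta>] base_change_def[of "\<lambda>p. \<theta> (\<eta> p)"] op_linear_sum)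
      (simp add: op_linear_def base_change_to_Q[OF assms])
qed

text \<open>An operator on \<open>\<int>\<^sub>2[\<xi>\<^sub>1, \<xi>\<^sub>2, \<dots>]\<close> may lie in the ideal after base change without lying in
  \<open>J2\<close>: this is the case of the vector fields.\<close>

definition in_plus :: "(dyadic mpoly \<Rightarrow> dyadic mpoly) \<Rightarrow> bool" where
  "in_plus A \<longleftrightarrow> base_change A \<in> J2plus"

lemma in_plus_add: "in_plus A \<Longrightarrow> in_plus B \<Longrightarrow> in_plus (\<lambda>p. A p + B p)"
  unfolding in_plus_def base_change_add by (rule J2plus.add)

lemma in_plus_scale: "in_plus A \<Longrightarrow> in_plus (\<lambda>p. scale c (A p))"
  unfolding in_plus_def base_change_scale by (rule J2plus_scale)

lemma in_plus_diff:
  assumes "in_plus A" "in_plus B"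
  shows "in_plus (\<lambda>p. A p - B p)"
proof -
  have "(\<lambda>p. A p - B p) = (\<lambda>p. A p + scale (-1) (B p))"
    by (intro ext poly_mapping_eqI) (simp add: lookup_add lookup_minus)
  then show ?thesis using in_plus_add[OF assms(1) in_plus_scale[OF assms(2), of "-1"]] by simp
qed

lemma in_plus_zero: "in_plus (\<lambda>_. 0)"
  using in_plus_scale[of "Jqk 1" 0] J2plus.gen1 by (simp add: in_plus_def)

lemma in_plus_sum: "(\<And>j. j \<in> I \<Longrightarrow> in_plus (A j)) \<Longrightarrow> in_plus (\<lambda>p. \<Sum>j\<in>I. A j p)"
  by (induction I rule: infinite_finite_induct) (simp_all add: in_plus_zero in_plus_add)

text \<open>Positive integers are invertible in the rational coefficients. This is where passing to
  the fraction field matters, since Newton's identity and the commutators carry integer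
  factors.\<close>

lemma in_plus_divide:
  assumes "in_plus (\<lambda>p. scale (of_nat k) (A p))" "k > 0"
  shows "in_plus A"
proof -
  let ?c = "to_fract (of_nat k :: dyadic)"
  have "?c \<noteq> 0" using of_nat_dyadic_neq_0[OF assms(2)] by simp
  moreover have "(\<lambda>p. scale (1 / ?c) (base_change (\<lambda>p. scale (of_nat k) (A p)) p)) \<in> J2plus"
    using assms(1) unfolding in_plus_def by (rule J2plus_scale)
  ultimately show ?thesis
    by (simp add: in_plus_def base_change_scale)
qed

lemma in_plus_left: "A \<in> J2 \<Longrightarrow> in_plus B \<Longrightarrow> in_plus (\<lambda>p. A (B p))"
  unfolding in_plus_def base_change_comp_linear[OF J2_linear]
  by (intro J2plus.left J2Q.base)

lemma in_plus_right: "op_linear A \<Longrightarrow> in_plus A \<Longrightarrow> B \<in> J2 \<Longrightarrow> in_plus (\<lambda>p. A (B p))"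
  unfolding in_plus_def base_change_comp_linear
  by (intro J2plus.right J2Q.base)

lemma vfield_1: "vfield 1 = Jqk 1"
  using Jqk_newton[of 1] by (auto simp: Jqk_0)

lemma vfield_2: "scale (of_nat 2) (vfield 2 p) = Jqk 1 (Jqk 1 p) - scale 2 (Jqk 2 p)"
  using Jqk_newton[of 2 p] vfield_1
  by (intro poly_mapping_eqI) (simp add: Jqk_0 numeral_2_eq_2 lookup_minus lookup_add poly_mapping_eq_iff fun_eq_iff)

lemma vfield_in_plus: "r \<ge> 1 \<Longrightarrow> in_plus (vfield r)"
proof (induction r rule: nat_induct_at_least)
  case base
  show ?case unfolding vfield_1 in_plus_def by (rule J2plus.gen1)
next
  case (Suc r)
  have J1: "in_plus (vfield 1)" "vfield 1 \<in> J2"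
    unfolding vfield_1 in_plus_def by (rule J2plus.gen1 J2.gen)+
  show ?case
  proof (cases "r = 1")
    case True
    \<comment> \<open>The commutator factor \<open>r - 1\<close> vanishes here, so the second field
      has to come from Newton's identity for \<open>k = 2\<close>, and with it the generator
      \<open>Jqk 2\<close>.\<close>
    have "in_plus (\<lambda>p. scale (of_nat 2) (vfield 2 p))"
      unfolding vfield_2
    proof (rule in_plus_diff)
      show "in_plus (\<lambda>p. Jqk 1 (Jqk 1 p))"
        using in_plus_left[OF J1(2) J1(1)] by (simp only: vfield_1)
      show "in_plus (\<lambda>p. scale 2 (Jqk 2 p))"
        using J2plus.gen2 by (intro in_plus_scale) (simp only: in_plus_def)
    qed
    then have "in_plus (vfield 2)" by (rule in_plus_divide) simp
    then show ?thesis using True by (simp add: numeral_2_eq_2)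
  next
    case False
    \<comment> \<open>Both composites lie in the ideal because the other factor,
      \<open>vfield 1 = Jqk 1\<close>, belongs to \<open>J2\<close>.\<close>
    have "in_plus (\<lambda>p. scale (of_nat (r - 1)) (vfield (Suc r) p))"
      unfolding vfield_commutator[OF Suc.hyps]
      by (rule in_plus_diff[OF in_plus_left[OF J1(2) Suc.IH] in_plus_right[OF vfield_linear Suc.IH J1(2)]])
    then show ?thesis by (rule in_plus_divide) (use False Suc.hyps in simp)
  qed
qed

text \<open>Every summand of Newton's identity is a field of positive index, hence in the ideal,
  composed on the right with an element of \<open>J2\<close>; then divide by
  \<open>k\<close>.\<close>

lemma Jqk_in_plus:
  assumes "k \<ge> 1"
  shows "in_plus (Jqk k)"
proof (rule in_plus_divide)
  show "in_plus (\<lambda>p. scale (of_nat k) (Jqk k p))"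
    unfolding Jqk_newton
    by (intro in_plus_sum in_plus_scale in_plus_right[OF vfield_linear vfield_in_plus J2.gen]) simp
qed (use assms in simp)


section \<open>The open unit ball of the Adem norm\<close>

lemma adem_ball_mono: "r \<le> s \<Longrightarrow> adem_ball r \<subseteq> adem_ball s"
  by (auto simp: adem_ball_def)

text \<open>\<open>GREATEST\<close> has its intended meaning: the exponents include 0, and they are
  bounded because the operator raises degrees by a bounded amount.\<close>

lemma greatest_power:
  assumes "\<sigma> \<in> J2Q" "\<sigma> \<noteq> (\<lambda>_. 0)"
  shows "\<sigma> \<in> J2plus_power (GREATEST j. \<sigma> \<in> J2plus_power j)"
    and "\<sigma> \<in> J2plus_power j \<Longrightarrow> j \<le> (GREATEST j. \<sigma> \<in> J2plus_power j)"
proof -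
  obtain b where b: "\<forall>j. \<sigma> \<in> J2plus_power j \<longrightarrow> j \<le> b" using J2plus_power_bounded[OF assms] by blast
  show "\<sigma> \<in> J2plus_power (GREATEST j. \<sigma> \<in> J2plus_power j)"
    by (rule GreatestI_nat[of "\<lambda>j. \<sigma> \<in> J2plus_power j" 0 b]) (use b assms(1) in auto)
  show "j \<le> (GREATEST j. \<sigma> \<in> J2plus_power j)" if "\<sigma> \<in> J2plus_power j"
    by (rule Greatest_le_nat[of "\<lambda>j. \<sigma> \<in> J2plus_power j" j b]) (use b that in auto)
qed

lemma Jqk_in_adem_ball:
  assumes "k \<ge> 1"
  shows "Jqk k \<in> adem_ball 1"
proof -
  have Q: "base_change (Jqk k) \<in> J2Q" by (intro J2Q.base J2.gen)
  \<comment> \<open>The first power is by definition a product with the zeroth power, the whole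
    algebra; the identity serves as left factor.\<close>
  have "(\<lambda>p. p) \<circ> base_change (Jqk k) \<in> ideal_mult J2Q J2plus"
    using Jqk_in_plus[OF assms] scale_in_J2Q[of 1] unfolding in_plus_def
    by (intro ideal_mult.prod) simp_all
  then have P: "base_change (Jqk k) \<in> J2plus_power 1" by (simp add: comp_def)
  have "adem_norm (Jqk k) < 1"
  proof (cases "base_change (Jqk k) = (\<lambda>_. 0)")
    case False
    then have "1 \<le> (GREATEST j. base_change (Jqk k) \<in> J2plus_power j)"
      using greatest_power(2)[OF Q False P] by simp
    then show ?thesis using False by (simp add: adem_norm_def adem_norm_Q_def)
  qed (simp add: adem_norm_def adem_norm_Q_def)
  then show ?thesis by (simp add: adem_ball_def J2.gen)
qed

text \<open>A norm below 1 forces a positive exponent, and each factor from the ideal raises degrees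
  by at least one.\<close>

lemma adem_ball_raises:
  assumes "\<theta> \<in> adem_ball 1"
  shows "raises_ge 1 (base_change \<theta>)"
proof (cases "base_change \<theta> = (\<lambda>_. 0)")
  case True
  then show ?thesis by (simp add: raises_ge_def)
next
  case False
  let ?G = "GREATEST j. base_change \<theta> \<in> J2plus_power j"
  have \<theta>: "\<theta> \<in> J2" "adem_norm \<theta> < 1" using assms by (auto simp: adem_ball_def)
  then have "1 \<le> ?G"
    using False by (cases "?G = 0") (auto simp: adem_norm_def adem_norm_Q_def)
  moreover have "raises_ge ?G (base_change \<theta>)"
    using J2plus_power_raises greatest_power(1)[OF J2Q.base[OF \<theta>(1)] False] by blast
  ultimately show ?thesis using raises_ge_mono by blast
qed

lemma adem_ball_constant:
  assumes "\<theta> \<in> adem_ball 1"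
  shows "lookup (\<theta> 1) 0 = 0"
proof -
  have "\<forall>m\<in>keys (Poly_Mapping.single (0::mono) (1 :: dyadic fract)). 0 \<le> mdeg m" by simp
  then have "\<forall>m\<in>keys (base_change \<theta> (Poly_Mapping.single 0 1)). 0 + 1 \<le> mdeg m"
    using adem_ball_raises[OF assms] unfolding raises_ge_def by blast
  then have "0 \<notin> keys (\<theta> (mon 0))"
    unfolding base_change_single keys_to_Q by force
  then show ?thesis by (simp add: in_keys_iff)
qed


section \<open>The action on power series\<close>

lemma series_add: "f \<in> series n \<Longrightarrow> g \<in> series n \<Longrightarrow> (\<lambda>m. f m + g m) \<in> series n"
  by (simp add: series_def) (metis add_0)

lemma series_scale: "f \<in> series n \<Longrightarrow> (\<lambda>m. c * f m) \<in> series n"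
  unfolding series_def by auto

lemma series_zero: "(\<lambda>_. 0) \<in> series n"
  unfolding series_def by auto

text \<open>Each of the \<open>n\<close> exponents is bounded by the total degree. Hence the
  homogeneous components of a series are polynomials.\<close>

lemma finite_slice: "finite {m. keys m \<subseteq> {..<n} \<and> mdeg m = d}"
proof (rule finite_imageD)
  let ?S = "{m. keys m \<subseteq> {..<n} \<and> mdeg m = d}"
  have le: "lookup m i \<le> mdeg m" for m i
    by (cases "i \<in> keys m") (auto simp: mdeg_def in_keys_iff intro: member_le_sum)
  have "lookup ` ?S \<subseteq> {f. \<forall>i. (i \<in> {..<n} \<longrightarrow> f i \<in> {..d}) \<and> (i \<notin> {..<n} \<longrightarrow> f i = 0)}"
    using le by (auto simp: in_keys_iff)
  then show "finite (lookup ` ?S)"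
    by (rule finite_subset) (rule finite_set_of_finite_funs, simp_all)
  show "inj_on lookup ?S" by (simp add: inj_on_def poly_mapping_eqI)
qed

lemma lookup_hpart_series:
  assumes "f \<in> series n"
  shows "lookup (hpart d f) m = (if mdeg m = d then f m else 0)"
proof -
  have "finite {m. f m \<noteq> 0 \<and> mdeg m = d}"
    by (rule finite_subset[OF _ finite_slice[of n d]]) (use assms in \<open>auto simp: series_def\<close>)
  then show ?thesis
    by (auto simp: hpart_def lookup_sum lookup_single when_def)
qed

text \<open>By linearity, a coefficient of \<open>act \<theta> f\<close> is then read off from one
  application of \<open>\<theta>\<close> to one polynomial.\<close>

definition trunc :: "nat \<Rightarrow> dyadic mseries \<Rightarrow> dyadic mpoly" where
  "trunc N f = (\<Sum>d\<le>N. hpart d f)"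

lemma lookup_trunc:
  assumes "f \<in> series n"
  shows "lookup (trunc N f) m = (if mdeg m \<le> N then f m else 0)"
  unfolding trunc_def lookup_sum lookup_hpart_series[OF assms] by auto

lemma trunc_add:
  "f \<in> series n \<Longrightarrow> g \<in> series n \<Longrightarrow> trunc N (\<lambda>m. f m + g m) = trunc N f + trunc N g"
  by (rule poly_mapping_eqI) (simp add: lookup_add lookup_trunc[OF series_add] lookup_trunc)

lemma trunc_scale: "f \<in> series n \<Longrightarrow> trunc N (\<lambda>m. c * f m) = scale c (trunc N f)"
  by (rule poly_mapping_eqI) (simp add: lookup_trunc[OF series_scale] lookup_trunc)

lemma act_trunc: "op_linear \<theta> \<Longrightarrow> act \<theta> f m = lookup (\<theta> (trunc (mdeg m) f)) m"
  by (simp add: act_def trunc_def op_linear_sum lookup_sum)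

lemma act_add:
  assumes "op_linear \<theta>" "f \<in> series n" "g \<in> series n"
  shows "act \<theta> (\<lambda>m. f m + g m) m = act \<theta> f m + act \<theta> g m"
  using assms by (simp add: act_trunc trunc_add lookup_add op_linear_def)

lemma act_scale:
  assumes "op_linear \<theta>" "f \<in> series n"
  shows "act \<theta> (\<lambda>m. c * f m) m = c * act \<theta> f m"
  using assms by (simp add: act_trunc trunc_scale op_linear_def)

lemma act_zero: "op_linear \<theta> \<Longrightarrow> act \<theta> (\<lambda>_. 0) m = 0"
  using act_scale[OF _ series_zero, of \<theta> 0] by simp

lemma act_id: "f \<in> series n \<Longrightarrow> act (\<lambda>p. p) f m = f m"
  by (simp add: act_trunc op_linear_id lookup_trunc)

text \<open>The difference \<open>p - q\<close> starts above degree \<open>N\<close>, and so does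
  its image, as \<open>\<theta>\<close> does not lower degrees.\<close>

lemma lookup_low_degree:
  assumes "op_linear \<theta>" "raises_ge 0 \<theta>" "\<And>x. mdeg x \<le> N \<Longrightarrow> lookup p x = lookup q x" "mdeg m \<le> N"
  shows "lookup (\<theta> p) m = lookup (\<theta> (q :: dyadic mpoly)) m"
proof -
  have "\<forall>x\<in>keys (p - q). Suc N \<le> mdeg x"
    using assms(3) by (force simp: in_keys_iff lookup_minus not_less_eq_eq[symmetric])
  then have "\<forall>x\<in>keys (\<theta> (p - q)). Suc N + 0 \<le> mdeg x"
    using assms(2) unfolding raises_ge_def by blast
  then have "lookup (\<theta> (p - q)) m = 0" using assms(4) by (force simp: in_keys_iff)
  moreover have "\<theta> p = \<theta> (p - q) + \<theta> q"
    using assms(1) unfolding op_linear_def by (metis diff_add_cancel)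
  ultimately show ?thesis by (simp add: lookup_add)
qed

lemma act_trunc_le:
  assumes "\<theta> \<in> J2" "f \<in> series n" "mdeg m \<le> N"
  shows "act \<theta> f m = lookup (\<theta> (trunc N f)) m"
  unfolding act_trunc[OF J2_linear[OF assms(1)]]
proof (rule lookup_low_degree[OF J2_linear[OF assms(1)]])
  show "raises_ge 0 \<theta>" using J2_raises[OF assms(1)] by blast
  show "lookup (trunc (mdeg m) f) x = lookup (trunc N f) x" if "mdeg x \<le> mdeg m" for x
    using that assms(3) by (simp add: lookup_trunc[OF assms(2)])
qed simp

lemma keys_Jq:
  assumes "x \<in> keys (Jq p)"
  shows "\<exists>m\<in>keys p. keys x \<subseteq> keys m"
proof -
  have "x \<in> keys (\<Sum>m\<in>keys p. scale (lookup p m) (Jq (mon m)))"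
    using assms op_linear_expand[OF op_linear_Jq, of p] by simp
  then obtain m where "m \<in> keys p" "x \<in> keys (scale (lookup p m) (Jq (mon m)))"
    using keys_sumD by blast
  then show ?thesis using keys_Jq_mon keys_scaleD by blast
qed

lemma keys_Jqk_vars:
  assumes "x \<in> keys (Jqk k p)"
  shows "\<exists>m\<in>keys p. keys x \<subseteq> keys m"
proof -
  obtain d where "x \<in> keys (hpart (d + k) (lookup (Jq (hpart d (lookup p)))))"
    using assms keys_sumD unfolding Jqk_def by blast
  then have "x \<in> keys (Jq (hpart d (lookup p)))"
    by (auto simp: in_keys_iff lookup_hpart split: if_splits)
  then obtain m where "m \<in> keys (hpart d (lookup p))" "keys x \<subseteq> keys m"
    using keys_Jq by blast
  then show ?thesis by (intro bexI[of _ m]) (auto simp: in_keys_iff lookup_hpart split: if_splits)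
qed

text \<open>The squares introduce no variables, and this survives sums, scalars and composition; it
  keeps the action inside \<open>series n\<close>.\<close>

lemma J2_vars: "\<theta> \<in> J2 \<Longrightarrow> x \<in> keys (\<theta> p) \<Longrightarrow> \<exists>m\<in>keys p. keys x \<subseteq> keys m"
proof (induction arbitrary: x p rule: J2.induct)
  case (gen k)
  then show ?case by (rule keys_Jqk_vars)
next
  case (scale \<theta> c)
  then show ?case using keys_scaleD by blast
next
  case (add \<theta> \<eta>)
  show ?case using keys_addD[OF add.prems] add.IH by blast
next
  case (comp \<theta> \<eta>)
  then show ?case by (metis comp_apply order_trans)
qed

lemma act_series:
  assumes "\<theta> \<in> J2" "f \<in> series n"
  shows "act \<theta> f \<in> series n"
proof -
  have "keys m \<subseteq> {..<n}" if m: "act \<theta> f m \<noteq> 0" for m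
  proof -
    have "m \<in> keys (\<theta> (trunc (mdeg m) f))"
      using m act_trunc[OF J2_linear[OF assms(1)]] by (simp add: in_keys_iff)
    then obtain x where "x \<in> keys (trunc (mdeg m) f)" "keys m \<subseteq> keys x"
      using J2_vars[OF assms(1)] by blast
    moreover have "f x \<noteq> 0"
      using calculation(1) by (auto simp: in_keys_iff lookup_trunc[OF assms(2)] split: if_splits)
    ultimately show ?thesis using assms(2) unfolding series_def by blast
  qed
  then show ?thesis by (simp add: series_def)
qed

text \<open>Coefficients up to the degree of \<open>m\<close> see only terms up to that degree, so
  truncating before or after \<open>\<eta>\<close> gives the same result.\<close>

lemma act_comp:
  assumes "\<theta> \<in> J2" "\<eta> \<in> J2" "f \<in> series n"
  shows "act (\<theta> \<circ> \<eta>) f = act \<theta> (act \<eta> f)"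
proof
  fix m
  have "lookup (\<theta> (\<eta> (trunc (mdeg m) f))) m = lookup (\<theta> (trunc (mdeg m) (act \<eta> f))) m"
  proof (rule lookup_low_degree[OF J2_linear[OF assms(1)]])
    show "raises_ge 0 \<theta>" using J2_raises[OF assms(1)] by blast
    show "lookup (\<eta> (trunc (mdeg m) f)) x = lookup (trunc (mdeg m) (act \<eta> f)) x" if "mdeg x \<le> mdeg m" for x
      using that by (simp add: lookup_trunc[OF act_series[OF assms(2,3)]] act_trunc_le[OF assms(2,3)])
  qed simp
  then show "act (\<theta> \<circ> \<eta>) f m = act \<theta> (act \<eta> f) m"
    by (simp add: act_trunc[OF J2_linear[OF J2.comp[OF assms(1,2)]]] act_trunc[OF J2_linear[OF assms(1)]])
qed


section \<open>Hit elements\<close>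

lemma hitE:
  assumes "hit n f"
  obtains r g where "\<And>i. g i \<in> series n" "\<And>i. g i 0 = 0"
    "\<And>s m. r \<le> s \<Longrightarrow> f m = (\<Sum>i = 1..s. act (Jqk i) (g i) m)"
proof -
  obtain r g where g: "\<forall>i\<in>{1..r}. g i \<in> series n \<and> g i 0 = 0"
    "f = (\<lambda>m. \<Sum>i = 1..r. act (Jqk i) (g i) m)"
    using assms unfolding hit_def by blast
  define h where "h i = (if i \<in> {1..r} then g i else (\<lambda>_. 0))" for i
  show thesis
  proof (rule that)
    show "h i \<in> series n" "h i 0 = 0" for i
      using g(1) by (auto simp: h_def series_zero)
    show "f m = (\<Sum>i = 1..s. act (Jqk i) (h i) m)" if "r \<le> s" for s m
      unfolding g(2) using that
      by (intro sum.mono_neutral_cong_left) (auto simp: h_def act_zero Jqk_linear)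
  qed
qed

lemma hitI:
  assumes "\<And>i. g i \<in> series n" "\<And>i. g i 0 = 0" "\<And>m. f m = (\<Sum>i = 1..r. act (Jqk i) (g i) m)"
  shows "hit n f"
  unfolding hit_def using assms by (intro exI[of _ r] exI[of _ g]) auto

lemma hit_zero: "hit n (\<lambda>_. 0)"
  by (rule hitI[of "\<lambda>_ _. 0" _ _ 0]) (simp_all add: series_zero)

lemma hit_add:
  assumes "hit n f" "hit n f'"
  shows "hit n (\<lambda>m. f m + f' m)"
proof -
  obtain r g where g: "\<And>i. g i \<in> series n" "\<And>i. g i 0 = 0"
    "\<And>s m. r \<le> s \<Longrightarrow> f m = (\<Sum>i = 1..s. act (Jqk i) (g i) m)"
    using hitE[OF assms(1)] by metis
  obtain r' g' where g': "\<And>i. g' i \<in> series n" "\<And>i. g' i 0 = 0"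
    "\<And>s m. r' \<le> s \<Longrightarrow> f' m = (\<Sum>i = 1..s. act (Jqk i) (g' i) m)"
    using hitE[OF assms(2)] by metis
  show ?thesis
  proof (rule hitI)
    show "(\<lambda>m. g i m + g' i m) \<in> series n" for i using g g' by (intro series_add)
    show "f m + f' m = (\<Sum>i = 1..max r r'. act (Jqk i) (\<lambda>m. g i m + g' i m) m)" for m
      using g(3)[of "max r r'"] g'(3)[of "max r r'"]
      by (simp add: act_add[OF Jqk_linear g(1) g'(1)] sum.distrib)
  qed (simp add: g g')
qed

lemma hit_scale:
  assumes "hit n f"
  shows "hit n (\<lambda>m. c * f m)"
proof -
  obtain r g where g: "\<And>i. g i \<in> series n" "\<And>i. g i 0 = 0"
    "\<And>s m. r \<le> s \<Longrightarrow> f m = (\<Sum>i = 1..s. act (Jqk i) (g i) m)"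
    using hitE[OF assms] by metis
  show ?thesis
  proof (rule hitI)
    show "(\<lambda>m. c * g i m) \<in> series n" for i using g by (intro series_scale)
    show "c * f m = (\<Sum>i = 1..r. act (Jqk i) (\<lambda>m. c * g i m) m)" for m
      using g(3)[of r] by (simp add: act_scale[OF Jqk_linear g(1)] sum_distrib_left)
  qed (simp add: g)
qed

lemma hit_sum:
  fixes r :: nat
  assumes "\<And>i. i < r \<Longrightarrow> hit n (f i)"
  shows "hit n (\<lambda>m. \<Sum>i<r. f i m)"
  using assms by (induction r) (simp_all add: hit_zero hit_add)

lemma hit_series:
  assumes "hit n f"
  shows "f \<in> series n"
proof -
  obtain r g where g: "\<And>i. g i \<in> series n" "\<And>i. g i 0 = 0"
    "\<And>s m. r \<le> s \<Longrightarrow> f m = (\<Sum>i = 1..s. act (Jqk i) (g i) m)"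
    using hitE[OF assms] by metis
  have "f m = 0" if "\<not> keys m \<subseteq> {..<n}" for m
  proof -
    have "act (Jqk i) (g i) m = 0" for i
      using act_series[OF J2.gen g(1)] that unfolding series_def by blast
    then show ?thesis using g(3)[of r] by simp
  qed
  then show ?thesis unfolding series_def by blast
qed

lemma act_Jqk_at_0: "k \<ge> 1 \<Longrightarrow> act (Jqk k) g 0 = 0"
  using keys_Jqk[of 0 k] by (force simp: act_def in_keys_iff)

lemma hit_at_0:
  assumes "hit n f"
  shows "f 0 = 0"
proof -
  obtain r g where g: "\<And>i. g i \<in> series n" "\<And>i. g i 0 = 0"
    "\<And>s m. r \<le> s \<Longrightarrow> f m = (\<Sum>i = 1..s. act (Jqk i) (g i) m)"
    using hitE[OF assms] by metis
  show ?thesis using g(3)[of r 0] by (simp add: act_Jqk_at_0)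
qed

section \<open>Operators modulo hit elements, tested on the constant series 1\<close>

definition one_series :: "dyadic mseries" where
  "one_series m = (if m = 0 then 1 else 0)"

lemma one_series: "one_series \<in> series n"
  by (simp add: series_def one_series_def)

lemma trunc_one_series: "trunc N one_series = 1"
  by (rule poly_mapping_eqI) (simp add: lookup_trunc[OF one_series] one_series_def lookup_one when_def)

lemma hit_Jqk:
  assumes "k \<ge> 1" "g \<in> series n"
  shows "hit n (act (Jqk k) g)"
proof -
  \<comment> \<open>\<open>hit\<close> asks for zero constant terms; removing the one of
    \<open>g\<close> is harmless because \<open>Jqk k\<close> kills constants for
    \<open>k \<ge> 1\<close>.\<close>
  define g' where "g' m = g m + (- g 0) * one_series m" for m
  have g': "g' \<in> series n" "g' 0 = 0"
  proof -
    show "g' \<in> series n"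
      unfolding g'_def by (rule series_add[OF assms(2) series_scale[OF one_series]])
  qed (simp add: g'_def one_series_def)
  have "Jqk k 1 = 0"
    using Jqk_mon[of k 0] hpart_mon[of k 0] assms(1) by (simp add: Jq_one)
  then have "act (Jqk k) one_series m = 0" for m
    by (simp add: act_trunc[OF Jqk_linear] trunc_one_series)
  then have *: "act (Jqk k) g m = act (Jqk k) g' m" for m
    using act_add[OF Jqk_linear assms(2) series_scale[OF one_series], of k "- g 0" m]
      act_scale[OF Jqk_linear one_series, of k "- g 0" m]
    unfolding g'_def by simp
  show ?thesis
  proof (rule hitI)
    show "(if i = k then g' else (\<lambda>_. 0)) \<in> series n" for i using g' series_zero by simp
    show "(if i = k then g' else (\<lambda>_. 0)) 0 = 0" for i using g' by simp
    have "(\<Sum>i = 1..k. act (Jqk i) (if i = k then g' else (\<lambda>_. 0)) m) =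
          (\<Sum>i = 1..k. if i = k then act (Jqk k) g' m else 0)" for m
      by (rule sum.cong) (simp_all add: act_zero Jqk_linear)
    then show "act (Jqk k) g m = (\<Sum>i = 1..k. act (Jqk i) (if i = k then g' else (\<lambda>_. 0)) m)" for m
      using * assms(1) by simp
  qed
qed

text \<open>The scalar is 1 for \<open>Jqk 0\<close>, 0 for the other squares, and is additive and
  multiplicative. It is chosen before \<open>g\<close>, so a single test series determines
  it.\<close>

lemma J2_scalar_mod_hit:
  assumes "\<theta> \<in> J2"
  shows "\<exists>c. \<forall>g\<in>series n. hit n (\<lambda>m. act \<theta> g m - c * g m)"
  using assms
proof (induction rule: J2.induct)
  case (gen k)
  show ?case
  proof (cases "k = 0")
    case True
    then show ?thesis by (intro exI[of _ 1]) (simp add: Jqk_0 act_id hit_zero)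
  next
    case False
    then show ?thesis using hit_Jqk[of k _ n] by (intro exI[of _ 0]) simp
  qed
next
  case (scale \<theta> a)
  then obtain c where c: "\<forall>g\<in>series n. hit n (\<lambda>m. act \<theta> g m - c * g m)" by blast
  have "act (\<lambda>p. Defs.scale a (\<theta> p)) g m = a * act \<theta> g m" for g m
    by (simp add: act_def sum_distrib_left)
  then show ?case
    using c hit_scale[of n "\<lambda>m. act \<theta> _ m - c * _ m" a]
    by (intro exI[of _ "a * c"]) (simp add: algebra_simps)
next
  case (add \<theta> \<eta>)
  then obtain c d where c: "\<forall>g\<in>series n. hit n (\<lambda>m. act \<theta> g m - c * g m)"
    and d: "\<forall>g\<in>series n. hit n (\<lambda>m. act \<eta> g m - d * g m)" by blast
  have "hit n (\<lambda>m. act (\<lambda>p. \<theta> p + \<eta> p) g m - (c + d) * g m)" if g: "g \<in> series n" for g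
  proof -
    have "act (\<lambda>p. \<theta> p + \<eta> p) g m = act \<theta> g m + act \<eta> g m" for m
      by (simp add: act_def lookup_add sum.distrib)
    then show ?thesis
      using hit_add[OF c[rule_format, OF g] d[rule_format, OF g]] by (simp add: algebra_simps)
  qed
  then show ?case by blast
next
  case (comp \<theta> \<eta>)
  then obtain c d where c: "\<forall>g\<in>series n. hit n (\<lambda>m. act \<theta> g m - c * g m)"
    and d: "\<forall>g\<in>series n. hit n (\<lambda>m. act \<eta> g m - d * g m)" by blast
  have "hit n (\<lambda>m. act (\<theta> \<circ> \<eta>) g m - (c * d) * g m)" if g: "g \<in> series n" for g
  proof -
    \<comment> \<open>The hypothesis on \<open>\<theta>\<close> is applied to the series
      \<open>act \<eta> g\<close>, which avoids applying \<open>\<theta>\<close> to a hit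
      element.\<close>
    have "hit n (\<lambda>m. (act \<theta> (act \<eta> g) m - c * act \<eta> g m) + c * (act \<eta> g m - d * g m))"
      using c d g act_series[OF comp.hyps(2) g] by (intro hit_add hit_scale) auto
    then show ?thesis by (simp add: act_comp[OF comp.hyps g] algebra_simps)
  qed
  then show ?case by blast
qed

lemma hit_adem_ball:
  assumes "\<theta> \<in> adem_ball 1" "g \<in> series n"
  shows "hit n (act \<theta> g)"
proof -
  have \<theta>: "\<theta> \<in> J2" using assms(1) by (simp add: adem_ball_def)
  obtain c where c: "\<forall>g\<in>series n. hit n (\<lambda>m. act \<theta> g m - c * g m)"
    using J2_scalar_mod_hit[OF \<theta>] by blast
  have "act \<theta> one_series 0 = 0"
    using adem_ball_constant[OF assms(1)] by (simp add: act_trunc[OF J2_linear[OF \<theta>]] trunc_one_series)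
  \<comment> \<open>Compare constant terms on the series 1: hit elements have none, and neither does
    its image under \<open>\<theta>\<close>, which leaves \<open>- c\<close>.\<close>
  then have "c = 0"
    using hit_at_0[OF c[rule_format, OF one_series]] by (simp add: one_series_def)
  then show ?thesis using c assms(2) by simp
qed

lemma hit_iff_op_series: "hit n f \<longleftrightarrow> f \<in> op_series (adem_ball 1) (series n)"
proof
  assume "hit n f"
  then obtain r g where g: "\<And>i. g i \<in> series n" "\<And>i. g i 0 = 0"
    "\<And>s m. r \<le> s \<Longrightarrow> f m = (\<Sum>i = 1..s. act (Jqk i) (g i) m)"
    using hitE by metis
  \<comment> \<open>\<open>hit\<close> numbers its squares from 1, \<open>op_series\<close> its
    operators from 0.\<close>
  have "f = (\<lambda>m. \<Sum>i<r. act (Jqk (Suc i)) (g (Suc i)) m)"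
    using g(3)[of r] by (simp add: sum.atLeast1_atMost_eq fun_eq_iff)
  then show "f \<in> op_series (adem_ball 1) (series n)"
    unfolding op_series_def using g(1) Jqk_in_adem_ball
    by (intro CollectI exI[of _ r] exI[of _ "\<lambda>i. Jqk (Suc i)"] exI[of _ "\<lambda>i. g (Suc i)"]) simp
next
  assume "f \<in> op_series (adem_ball 1) (series n)"
  then show "hit n f"
    unfolding op_series_def by (auto intro!: hit_sum hit_adem_ball)
qed

section \<open>From the open unit ball to the norm on power series\<close>

lemma op_series_mono: "B \<subseteq> C \<Longrightarrow> op_series B M \<subseteq> op_series C M"
  unfolding op_series_def by blast

lemma adem_norm_series_less_1_iff:
  "adem_norm_series n f < 1 \<longleftrightarrow> f \<in> op_series (adem_ball 1) (series n)"
proof -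
  let ?T = "{1 / 2 ^ (k + 1) | k :: nat. f \<in> op_series (adem_ball (1 / 2 ^ k)) (series n)} :: real set"
  have "bdd_below ({1} \<union> ?T)" by (rule bdd_belowI[of _ 0]) auto
  then have "adem_norm_series n f < 1 \<longleftrightarrow> (\<exists>x\<in>{1} \<union> ?T. x < 1)"
    unfolding adem_norm_series_def by (intro cInf_less_iff) auto
  also have "\<dots> \<longleftrightarrow> (\<exists>k::nat. f \<in> op_series (adem_ball (1 / 2 ^ k)) (series n))"
  proof -
    \<comment> \<open>Only the default member 1 of the set fails to lie below 1, so a norm below 1
      means membership for some \<open>k\<close>; the case \<open>k = 0\<close> has the largest
      ball.\<close>
    have "1 / 2 ^ (k + 1) < (1::real)" for k :: nat
      using one_less_power[of "2::real" "k + 1"] by (simp add: divide_less_eq)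
    then show ?thesis by auto
  qed
  also have "\<dots> \<longleftrightarrow> f \<in> op_series (adem_ball 1) (series n)"
  proof
    assume "\<exists>k::nat. f \<in> op_series (adem_ball (1 / 2 ^ k)) (series n)"
    then obtain k :: nat where "f \<in> op_series (adem_ball (1 / 2 ^ k)) (series n)" ..
    moreover have "1 / 2 ^ k \<le> (1::real)" by simp
    ultimately show "f \<in> op_series (adem_ball 1) (series n)"
      using op_series_mono[OF adem_ball_mono] by blast
  next
    assume "f \<in> op_series (adem_ball 1) (series n)"
    then show "\<exists>k::nat. f \<in> op_series (adem_ball (1 / 2 ^ k)) (series n)"
      by (intro exI[of _ 0]) simp
  qed
  finally show ?thesis .
qed

theorem theorem6p7:
  fixes n :: nat
  assumes "n \<ge> 1"
  shows "(\<forall>f\<in>series n. hit n f \<longleftrightarrow> adem_norm_series n f < 1) \<and>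
         hit_set n = op_series (adem_ball 1) (series n)"
  unfolding hit_set_def adem_norm_series_less_1_iff
  using hit_iff_op_series[of n] hit_series[of n] by blast

end
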